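(* Let $M$ be an $n$-dimensional manifold, $n>2$, and let $(g,\xi,\lambda,\mu)$ be an $\eta$-Ricci soliton on $M$ with $\eta$ the $g$-dual $1$-form of $\xi$. Then $\eta$ is a solution of the Schr\"odinger-Ricci equation if and only if $$d(scal)=2\mu\big[(scal+\lambda n+\mu|\xi|^2)\eta-\nabla_{\xi}\eta\big].$$ Moreover, in this case, $scal$ is constant if and only if $\mu=0$ or $(scal+\lambda n+\mu|\xi|^2)\eta=\nabla_{\xi}\eta$.
   Context: $g$ is a Riemannian metric on $M$, $\nabla$ its Levi-Civita connection, $S$ its Ricci curvature tensor field, $scal$ its scalar curvature. The $g$-dual $1$-form of a vector field $\xi$ is $\eta=\xi^{\flat}=g(\xi,\cdot)$. The data $(g,\xi,\lambda,\mu)$, with $\xi$ a vector field, $\eta$ a $1$-form and $\lambda,\mu$ real constants, is an $\eta$-Ricci soliton on $M$ if $L_{\xi}g+2S+2\lambda g+2\mu\,\eta\otimes\eta=0$, where $L$ is the Lie derivative. For a vector field $X$, the $1$-form $X^{\flat}$ is a solution of the Schr\"odinger-Ricci equation if $div(L_Xg)=0$, where for a symmetric $(0,2)$-tensor field $T$, $div(T)(Y)=\sum_i(\nabla_{E_i}T)(E_i,Y)$ for a local orthonormal frame $\{E_i\}$.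
   Formalization: The "moreover" part is stated for connected M: on a disjoint union of a flat Gaussian soliton and an Einstein sphere with the same λ<0 and μ=0, η solves the Schrödinger-Ricci equation but scal is not constant. The first equivalence needs no connectedness. *)

theory Defs
  imports "HOL-Analysis.Analysis"
begin

section \<open>Smooth maps between normed spaces\<close>

text \<open>
  \<open>Ck_on k S f\<close> is meant for open \<open>S\<close>; over a finite-dimensional domain it says that all
  iterated directional derivatives up to order \<open>k\<close> exist and are continuous on \<open>S\<close>.
\<close>

primrec Ck_on ::
  "nat \<Rightarrow> 'a::real_normed_vector set \<Rightarrow> ('a \<Rightarrow> 'b::real_normed_vector) \<Rightarrow> bool" where
  "Ck_on 0 S = (\<lambda>f. continuous_on S f)"
| "Ck_on (Suc k) S = (\<lambda>f. (\<forall>x\<in>S. f differentiable (at x)) \<and>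
     (\<forall>v. Ck_on k S (\<lambda>x. frechet_derivative f (at x) v)))"

definition smooth_on ::
  "'a::real_normed_vector set \<Rightarrow> ('a \<Rightarrow> 'b::real_normed_vector) \<Rightarrow> bool" where
  "smooth_on S f \<longleftrightarrow> (\<forall>k. Ck_on k S f)"


section \<open>Smooth manifolds\<close>

text \<open>
  The points of the manifold are the elements of a Hausdorff second countable type \<open>'m\<close>; its
  dimension is \<open>CARD('n)\<close>. A chart is a pair of an open domain and a coordinate map (whose
  values outside the domain are irrelevant).
\<close>

type_synonym ('m, 'n) chart = "'m set \<times> ('m \<Rightarrow> real ^ 'n)"

definition chart_inv :: "('m, 'n) chart \<Rightarrow> real ^ 'n \<Rightarrow> 'm" where
  "chart_inv c = inv_into (fst c) (snd c)"

definition smooth_atlas ::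
  "('m::{t2_space, second_countable_topology}, 'n::finite) chart set \<Rightarrow> bool" where
  "smooth_atlas A \<longleftrightarrow>
     (\<Union>c\<in>A. fst c) = UNIV \<and>
     (\<forall>c\<in>A. open (fst c) \<and> open (snd c ` fst c) \<and>
        homeomorphism (fst c) (snd c ` fst c) (snd c) (chart_inv c)) \<and>
     (\<forall>c\<in>A. \<forall>c'\<in>A. smooth_on (snd c ` (fst c \<inter> fst c')) (snd c' \<circ> chart_inv c))"

text \<open>
  Every point \<open>p\<close> gets a preferred chart \<open>chart_at A p\<close>. The tangent space at \<open>p\<close> is
  identified with \<open>real ^ 'n\<close> by taking components in that chart. So a vector field is a
  function \<open>'m \<Rightarrow> real ^ 'n\<close>, a 1-form is a function \<open>'m \<Rightarrow> real ^ 'n \<Rightarrow> real\<close>, and so on.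
  The preferred chart may jump from point to point, so smoothness of a field is always tested on
  its components in a fixed chart, to which they are transported by \<open>coord_change\<close>.
\<close>

definition chart_at :: "('m, 'n) chart set \<Rightarrow> 'm \<Rightarrow> ('m, 'n) chart" where
  "chart_at A p = (SOME c. c \<in> A \<and> p \<in> fst c)"

text \<open>\<open>coord_change c c' p\<close> takes the components in \<open>c\<close> of a tangent vector at \<open>p\<close> to its
  components in \<open>c'\<close>.\<close>

definition coord_change ::
  "('m, 'n::finite) chart \<Rightarrow> ('m, 'n) chart \<Rightarrow> 'm \<Rightarrow> real ^ 'n \<Rightarrow> real ^ 'n" where
  "coord_change c c' p = frechet_derivative (snd c' \<circ> chart_inv c) (at (snd c p))"

type_synonym ('m, 'n) vfield = "'m \<Rightarrow> real ^ 'n"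
type_synonym ('m, 'n) form1 = "'m \<Rightarrow> real ^ 'n \<Rightarrow> real"
type_synonym ('m, 'n) tensor2 = "'m \<Rightarrow> real ^ 'n \<Rightarrow> real ^ 'n \<Rightarrow> real"

text \<open>The components of \<open>X\<close> in the chart \<open>c\<close>, as a function of the coordinates.\<close>

definition vf_rep ::
  "('m, 'n::finite) chart set \<Rightarrow> ('m, 'n) chart \<Rightarrow> ('m, 'n) vfield \<Rightarrow> real ^ 'n \<Rightarrow> real ^ 'n" where
  "vf_rep A c X = (\<lambda>q. coord_change (chart_at A q) c q (X q)) \<circ> chart_inv c"

definition smooth_function ::
  "('m, 'n::finite) chart set \<Rightarrow> 'm set \<Rightarrow> ('m \<Rightarrow> real) \<Rightarrow> bool" where
  "smooth_function A U f \<longleftrightarrow> (\<forall>c\<in>A. smooth_on (snd c ` (fst c \<inter> U)) (f \<circ> chart_inv c))"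

definition smooth_vfield ::
  "('m, 'n::finite) chart set \<Rightarrow> 'm set \<Rightarrow> ('m, 'n) vfield \<Rightarrow> bool" where
  "smooth_vfield A U X \<longleftrightarrow> (\<forall>c\<in>A. smooth_on (snd c ` (fst c \<inter> U)) (vf_rep A c X))"

text \<open>The vector field on the domain of \<open>c\<close> with constant components \<open>v\<close> in \<open>c\<close>.\<close>

definition coord_field ::
  "('m, 'n::finite) chart set \<Rightarrow> ('m, 'n) chart \<Rightarrow> real ^ 'n \<Rightarrow> ('m, 'n) vfield" where
  "coord_field A c v = (\<lambda>q. coord_change c (chart_at A q) q v)"

text \<open>
  A vector field near \<open>p\<close> with value \<open>v\<close> at \<open>p\<close>. Below, a tensor field given by a
  formula in vector fields is evaluated on tangent vectors at \<open>p\<close> by inserting such extensions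
  into the formula; by tensoriality the value does not depend on the choice of extension.
\<close>

definition ext_at ::
  "('m, 'n::finite) chart set \<Rightarrow> 'm \<Rightarrow> real ^ 'n \<Rightarrow> ('m, 'n) vfield" where
  "ext_at A p v = coord_field A (chart_at A p) v"

text \<open>\<open>df A f p v\<close> is the differential \<open>(df)\<^sub>p(v)\<close>, i.e. the derivative of
  \<open>f\<close> at \<open>p\<close> along \<open>v\<close>.\<close>

definition df :: "('m, 'n::finite) chart set \<Rightarrow> ('m \<Rightarrow> real) \<Rightarrow> ('m, 'n) form1" where
  "df A f p v = frechet_derivative (f \<circ> chart_inv (chart_at A p)) (at (snd (chart_at A p) p)) v"

text \<open>The Lie bracket \<open>[X, Y]\<close>, with components \<open>X\<^sup>j \<partial>\<^sub>j Y\<^sup>i - Y\<^sup>j \<partial>\<^sub>j X\<^sup>i\<close>.\<close>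

definition bracket ::
  "('m, 'n::finite) chart set \<Rightarrow> ('m, 'n) vfield \<Rightarrow> ('m, 'n) vfield \<Rightarrow> ('m, 'n) vfield" where
  "bracket A X Y p =
     (let c = chart_at A p in
        frechet_derivative (vf_rep A c Y) (at (snd c p)) (X p)
      - frechet_derivative (vf_rep A c X) (at (snd c p)) (Y p))"


section \<open>Riemannian metrics and the Levi-Civita connection\<close>

definition riemannian_metric ::
  "('m, 'n::finite) chart set \<Rightarrow> ('m, 'n) tensor2 \<Rightarrow> bool" where
  "riemannian_metric A g \<longleftrightarrow>
     (\<forall>p. bilinear (g p) \<and> (\<forall>v w. g p v w = g p w v) \<and> (\<forall>v. v \<noteq> 0 \<longrightarrow> g p v v > 0)) \<and>
     (\<forall>c\<in>A. \<forall>v w. smooth_function A (fst c) (\<lambda>q. g q (coord_field A c v q) (coord_field A c w q)))"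

definition flat :: "('m, 'n) tensor2 \<Rightarrow> ('m, 'n) vfield \<Rightarrow> ('m, 'n) form1" where
  "flat g X = (\<lambda>p v. g p (X p) v)"

text \<open>
  \<open>nabla p v Y\<close> stands for \<open>(\<nabla>\<^sub>v Y)(p)\<close>, where \<open>v\<close> is a tangent vector at \<open>p\<close> and
  \<open>Y\<close> is a vector field that is smooth on some open neighbourhood of \<open>p\<close>. A connection acts on
  vector fields over arbitrary open sets, as is needed for local frames.
\<close>

type_synonym ('m, 'n) conn = "'m \<Rightarrow> real ^ 'n \<Rightarrow> ('m, 'n) vfield \<Rightarrow> real ^ 'n"

definition affine_connection ::
  "('m::topological_space, 'n::finite) chart set \<Rightarrow> ('m, 'n) conn \<Rightarrow> bool" where
  "affine_connection A nabla \<longleftrightarrow>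
     (\<forall>U X Y Z f. open U \<longrightarrow>
        smooth_vfield A U X \<longrightarrow> smooth_vfield A U Y \<longrightarrow> smooth_vfield A U Z \<longrightarrow>
        smooth_function A U f \<longrightarrow>
          smooth_vfield A U (\<lambda>q. nabla q (X q) Y) \<and>
          ((\<forall>q\<in>U. Y q = Z q) \<longrightarrow> (\<forall>p\<in>U. \<forall>v. nabla p v Y = nabla p v Z)) \<and>
          (\<forall>p\<in>U. linear (\<lambda>v. nabla p v Y)) \<and>
          (\<forall>p\<in>U. \<forall>v. nabla p v (\<lambda>q. Y q + Z q) = nabla p v Y + nabla p v Z) \<and>
          (\<forall>p\<in>U. \<forall>v. nabla p v (\<lambda>q. f q *\<^sub>R Y q) = f p *\<^sub>R nabla p v Y + df A f p v *\<^sub>R Y p))"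

definition levi_civita ::
  "('m::topological_space, 'n::finite) chart set \<Rightarrow> ('m, 'n) tensor2 \<Rightarrow> ('m, 'n) conn \<Rightarrow> bool"
  where
  "levi_civita A g nabla \<longleftrightarrow>
     affine_connection A nabla \<and>
     (\<forall>U X Y. open U \<longrightarrow> smooth_vfield A U X \<longrightarrow> smooth_vfield A U Y \<longrightarrow>
        (\<forall>p\<in>U. nabla p (X p) Y - nabla p (Y p) X = bracket A X Y p) \<and>
        (\<forall>p\<in>U. \<forall>v. df A (\<lambda>q. g q (X q) (Y q)) p v
            = g p (nabla p v X) (Y p) + g p (X p) (nabla p v Y)))"


section \<open>Derivatives of tensor fields\<close>

text \<open>\<open>(L\<^sub>X T)(Y, Z) = X(T(Y, Z)) - T([X, Y], Z) - T(Y, [X, Z])\<close>\<close>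

definition lie_deriv ::
  "('m, 'n::finite) chart set \<Rightarrow> ('m, 'n) vfield \<Rightarrow> ('m, 'n) tensor2 \<Rightarrow> ('m, 'n) tensor2" where
  "lie_deriv A X T p y z =
     (let Y = ext_at A p y; Z = ext_at A p z in
        df A (\<lambda>q. T q (Y q) (Z q)) p (X p) - T p (bracket A X Y p) z - T p y (bracket A X Z p))"

text \<open>\<open>cov_tensor A nabla T p x y z\<close> is \<open>(\<nabla>\<^sub>x T)(y, z)\<close> at \<open>p\<close>.\<close>

definition cov_tensor ::
  "('m, 'n::finite) chart set \<Rightarrow> ('m, 'n) conn \<Rightarrow> ('m, 'n) tensor2
     \<Rightarrow> 'm \<Rightarrow> real ^ 'n \<Rightarrow> real ^ 'n \<Rightarrow> real ^ 'n \<Rightarrow> real" where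
  "cov_tensor A nabla T p x y z =
     (let Y = ext_at A p y; Z = ext_at A p z in
        df A (\<lambda>q. T q (Y q) (Z q)) p x - T p (nabla p x Y) z - T p y (nabla p x Z))"

definition cov_form ::
  "('m, 'n::finite) chart set \<Rightarrow> ('m, 'n) conn \<Rightarrow> ('m, 'n) vfield \<Rightarrow> ('m, 'n) form1
     \<Rightarrow> ('m, 'n) form1" where
  "cov_form A nabla X \<omega> p y =
     (let Y = ext_at A p y in df A (\<lambda>q. \<omega> q (Y q)) p (X p) - \<omega> p (nabla p (X p) Y))"

definition local_orthonormal_frame ::
  "('m::topological_space, 'n::finite) chart set \<Rightarrow> ('m, 'n) tensor2 \<Rightarrow> 'm set
     \<Rightarrow> ('n \<Rightarrow> ('m, 'n) vfield) \<Rightarrow> bool" where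
  "local_orthonormal_frame A g U E \<longleftrightarrow>
     open U \<and> (\<forall>i. smooth_vfield A U (E i)) \<and>
     (\<forall>q\<in>U. \<forall>i j. g q (E i q) (E j q) = (if i = j then 1 else 0))"

text \<open>
  Some local orthonormal frame around \<open>p\<close>. It is only used in traces with respect to \<open>g\<close>,
  which do not depend on the choice.
\<close>

definition frame_at ::
  "('m::topological_space, 'n::finite) chart set \<Rightarrow> ('m, 'n) tensor2 \<Rightarrow> 'm
     \<Rightarrow> 'n \<Rightarrow> ('m, 'n) vfield" where
  "frame_at A g p = (SOME E. \<exists>U. p \<in> U \<and> local_orthonormal_frame A g U E)"

definition div_tensor ::
  "('m::topological_space, 'n::finite) chart set \<Rightarrow> ('m, 'n) tensor2 \<Rightarrow> ('m, 'n) conn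
     \<Rightarrow> ('m, 'n) tensor2 \<Rightarrow> ('m, 'n) form1" where
  "div_tensor A g nabla T p y =
     (\<Sum>i\<in>UNIV. cov_tensor A nabla T p (frame_at A g p i p) (frame_at A g p i p) y)"


section \<open>Curvature\<close>

text \<open>\<open>R(X, Y)Z = \<nabla>\<^sub>X \<nabla>\<^sub>Y Z - \<nabla>\<^sub>Y \<nabla>\<^sub>X Z - \<nabla>\<^bsub>[X, Y]\<^esub> Z\<close>\<close>

definition curvature ::
  "('m, 'n::finite) chart set \<Rightarrow> ('m, 'n) conn
     \<Rightarrow> 'm \<Rightarrow> real ^ 'n \<Rightarrow> real ^ 'n \<Rightarrow> real ^ 'n \<Rightarrow> real ^ 'n" where
  "curvature A nabla p x y z =
     (let X = ext_at A p x; Y = ext_at A p y; Z = ext_at A p z in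
        nabla p x (\<lambda>q. nabla q (Y q) Z) - nabla p y (\<lambda>q. nabla q (X q) Z)
      - nabla p (bracket A X Y p) Z)"

definition ricci ::
  "('m, 'n::finite) chart set \<Rightarrow> ('m, 'n) conn \<Rightarrow> ('m, 'n) tensor2" where
  "ricci A nabla p y z = trace (matrix (\<lambda>x. curvature A nabla p x y z))"

definition scal ::
  "('m::topological_space, 'n::finite) chart set \<Rightarrow> ('m, 'n) tensor2 \<Rightarrow> ('m, 'n) conn
     \<Rightarrow> 'm \<Rightarrow> real" where
  "scal A g nabla p = (\<Sum>i\<in>UNIV. ricci A nabla p (frame_at A g p i p) (frame_at A g p i p))"


section \<open>Solitons and the Schroedinger-Ricci equation\<close>

definition eta_ricci_soliton ::
  "('m, 'n::finite) chart set \<Rightarrow> ('m, 'n) tensor2 \<Rightarrow> ('m, 'n) conn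
     \<Rightarrow> ('m, 'n) vfield \<Rightarrow> ('m, 'n) form1 \<Rightarrow> real \<Rightarrow> real \<Rightarrow> bool" where
  "eta_ricci_soliton A g nabla \<xi> \<eta> lam \<mu> \<longleftrightarrow>
     smooth_vfield A UNIV \<xi> \<and>
     (\<forall>p v w. lie_deriv A \<xi> g p v w + 2 * ricci A nabla p v w + 2 * lam * g p v w
        + 2 * \<mu> * (\<eta> p v * \<eta> p w) = 0)"

definition schroedinger_ricci ::
  "('m::topological_space, 'n::finite) chart set \<Rightarrow> ('m, 'n) tensor2 \<Rightarrow> ('m, 'n) conn
     \<Rightarrow> ('m, 'n) form1 \<Rightarrow> bool" where
  "schroedinger_ricci A g nabla \<omega> \<longleftrightarrow>
     (\<exists>X. smooth_vfield A UNIV X \<and> \<omega> = flat g X \<and>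
        (\<forall>p y. div_tensor A g nabla (lie_deriv A X g) p y = 0))"

end

theory Submission
  imports Defs
begin

text \<open>
  In a chart the metric and the Christoffel symbols are smooth families of bilinear maps on an
  open subset of \<open>real ^ 'n\<close>, and there the second Bianchi identity is a computation with
  directional derivatives, which commute. Tracing it twice over a \<open>g\<close>-orthonormal basis and
  using that the curvature is skew for \<open>g\<close> gives \<open>d(scal)(w) = 2 \<Sum>\<^sub>i (\<nabla>\<^bsub>E\<^sub>i\<^esub> S)(w, E\<^sub>i)\<close>; as
  the soliton equation shows that \<open>S\<close> is symmetric, the right-hand side is \<open>2 div(S)(w)\<close>.
  The divergence of the soliton equation is then
  \<open>div(L\<^sub>\<xi> g) + d(scal) + 2\<mu> (div(\<xi>) \<eta> + \<nabla>\<^sub>\<xi> \<eta>) = 0\<close>, and its trace is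
  \<open>div(\<xi>) = - (scal + \<lambda>n + \<mu>|\<xi>|\<^sup>2)\<close>.
\<close>

section \<open>Calculus of smooth maps\<close>

text \<open>The preferred chart may jump between neighbouring points, so the raw components of a
  field cannot be differentiated: a field is rewritten in one fixed chart before any derivative is
  taken. The frame used in traces is likewise chosen afresh at every point. Before
  \<open>scal\<close> can be differentiated near \<open>p\<close>, a single smooth frame around
  \<open>p\<close> has to replace the unrelated frames selected at the nearby points; this is why
  smooth local frames and the basis independence of traces are established. \<open>curvature\<close>
  is evaluated on coordinate fields of the preferred chart. In another chart these are no longer
  constant, but they still commute, and this suffices for the usual formula in Christoffel symbols
  to hold in every chart. The factor 2 in front of the divergence of \<open>S\<close> arises because
  two of the three terms of the cyclic sum have the same double trace, with the same sign.
  Connectedness enters only where a vanishing differential has to yield a globally constant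
  \<open>scal\<close>.\<close>

abbreviation fderiv :: "('a::real_normed_vector \<Rightarrow> 'b::real_normed_vector) \<Rightarrow> 'a \<Rightarrow> 'a \<Rightarrow> 'b" where
  "fderiv f x \<equiv> frechet_derivative f (at x)"

lemma fderiv_eqI: "(f has_derivative f') (at x) \<Longrightarrow> fderiv f x = f'"
  using frechet_derivative_at by metis

lemma has_fderiv: "f differentiable (at x) \<Longrightarrow> (f has_derivative fderiv f x) (at x)"
  by (simp add: frechet_derivative_works)

lemma fderiv_cong:
  assumes "open S" "x \<in> S" "\<And>y. y \<in> S \<Longrightarrow> f y = g y" "f differentiable (at x)"
  shows "fderiv g x = fderiv f x"
  using has_derivative_transform_within_open[OF has_fderiv[OF assms(4)] assms(1,2)] assms(3)
  by (metis fderiv_eqI)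

lemma differentiable_cong:
  assumes "open S" "x \<in> S" "\<And>y. y \<in> S \<Longrightarrow> f y = g y" "f differentiable (at x)"
  shows "g differentiable (at x)"
  using has_derivative_transform_within_open[OF has_fderiv[OF assms(4)] assms(1,2)] assms(3)
  by (auto simp: differentiable_def)

lemma Ck_on_cong:
  assumes "open S" "Ck_on k S f" "\<And>x. x \<in> S \<Longrightarrow> f x = g x"
  shows "Ck_on k S g"
  using assms(2,3)
proof (induction k arbitrary: f g)
  case 0
  then show ?case using continuous_on_cong[of S S f g] by simp
next
  case (Suc k)
  have "g differentiable (at x)" if "x \<in> S" for x
    using Suc.prems that differentiable_cong[OF \<open>open S\<close>, of x f g] by auto
  moreover have "Ck_on k S (\<lambda>x. fderiv g x v)" for v
  proof (rule Suc.IH)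
    show "Ck_on k S (\<lambda>x. fderiv f x v)" using Suc.prems by simp
    show "fderiv f x v = fderiv g x v" if "x \<in> S" for x
      using Suc.prems that fderiv_cong[OF \<open>open S\<close>, of x f g] by simp
  qed
  ultimately show ?case by simp
qed

lemma Ck_on_subset: "Ck_on k S f \<Longrightarrow> T \<subseteq> S \<Longrightarrow> Ck_on k T f"
  by (induction k arbitrary: f) (auto intro: continuous_on_subset)

lemma Ck_on_SucD: "Ck_on (Suc k) S f \<Longrightarrow> Ck_on k S f"
proof (induction k arbitrary: f)
  case 0
  then show ?case
    by (auto intro!: continuous_at_imp_continuous_on differentiable_imp_continuous_within)
next
  case (Suc k)
  then show ?case by simp
qed

lemma Ck_on_const: "Ck_on k S (\<lambda>x. c)"
  by (induction k arbitrary: c) auto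

lemma Ck_on_bounded_linear:
  assumes "open S" "bounded_linear h" "Ck_on k S f"
  shows "Ck_on k S (\<lambda>x. h (f x))"
  using assms(3)
proof (induction k arbitrary: f)
  case 0
  then show ?case
    using continuous_on_compose2[OF linear_continuous_on[OF assms(2), of UNIV]] by auto
next
  case (Suc k)
  have d: "((\<lambda>x. h (f x)) has_derivative (\<lambda>v. h (fderiv f x v))) (at x)" if "x \<in> S" for x
    using that Suc.prems bounded_linear.has_derivative[OF assms(2) has_fderiv] by auto
  have "Ck_on k S (\<lambda>x. fderiv (\<lambda>x. h (f x)) x v)" for v
  proof (rule Ck_on_cong[OF assms(1) Suc.IH])
    show "Ck_on k S (\<lambda>x. fderiv f x v)" using Suc.prems by simp
    show "h (fderiv f x v) = fderiv (\<lambda>x. h (f x)) x v" if "x \<in> S" for x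
      using fderiv_eqI[OF d[OF that]] by simp
  qed
  with d show ?case by (auto simp: differentiable_def)
qed

lemma Ck_on_add:
  assumes "open S" "Ck_on k S f" "Ck_on k S g"
  shows "Ck_on k S (\<lambda>x. f x + g x)"
  using assms(2,3)
proof (induction k arbitrary: f g)
  case 0
  then show ?case by (auto intro: continuous_intros)
next
  case (Suc k)
  have d: "((\<lambda>x. f x + g x) has_derivative (\<lambda>v. fderiv f x v + fderiv g x v)) (at x)" if "x \<in> S" for x
    using that Suc.prems by (auto intro!: has_derivative_add has_fderiv)
  have "Ck_on k S (\<lambda>x. fderiv (\<lambda>x. f x + g x) x v)" for v
  proof (rule Ck_on_cong[OF assms(1) Suc.IH])
    show "Ck_on k S (\<lambda>x. fderiv f x v)" "Ck_on k S (\<lambda>x. fderiv g x v)" using Suc.prems by auto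
    show "fderiv f x v + fderiv g x v = fderiv (\<lambda>x. f x + g x) x v" if "x \<in> S" for x
      using fderiv_eqI[OF d[OF that]] by simp
  qed
  with d show ?case by (auto simp: differentiable_def)
qed

text \<open>The Leibniz rule produces products of an undifferentiated factor and a derivative, so
  the induction runs over all pairs of maps, and \<open>Ck_on_SucD\<close> lowers the order of the
  undifferentiated factor.\<close>

lemma Ck_on_bounded_bilinear:
  assumes "open S" "bounded_bilinear h" "Ck_on k S f" "Ck_on k S g"
  shows "Ck_on k S (\<lambda>x. h (f x) (g x))"
  using assms(3,4)
proof (induction k arbitrary: f g)
  case 0
  then show ?case using bounded_bilinear.continuous_on[OF assms(2)] by auto
next
  case (Suc k)
  have d: "((\<lambda>x. h (f x) (g x)) has_derivative (\<lambda>v. h (f x) (fderiv g x v) + h (fderiv f x v) (g x))) (at x)"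
    if "x \<in> S" for x
    using that Suc.prems by (auto intro!: bounded_bilinear.FDERIV[OF assms(2)] has_fderiv)
  have "Ck_on k S (\<lambda>x. fderiv (\<lambda>x. h (f x) (g x)) x v)" for v
  proof (rule Ck_on_cong[OF assms(1)])
    have "Ck_on k S f" "Ck_on k S g" "Ck_on k S (\<lambda>x. fderiv f x v)" "Ck_on k S (\<lambda>x. fderiv g x v)"
      using Suc.prems Ck_on_SucD by auto
    then show "Ck_on k S (\<lambda>x. h (f x) (fderiv g x v) + h (fderiv f x v) (g x))"
      by (intro Ck_on_add[OF assms(1)] Suc.IH)
    show "h (f x) (fderiv g x v) + h (fderiv f x v) (g x) = fderiv (\<lambda>x. h (f x) (g x)) x v" if "x \<in> S" for x
      using fderiv_eqI[OF d[OF that]] by simp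
  qed
  with d show ?case by (auto simp: differentiable_def)
qed

lemma smooth_on_differentiable: "smooth_on S f \<Longrightarrow> x \<in> S \<Longrightarrow> f differentiable (at x)"
  unfolding smooth_on_def by (metis Ck_on.simps(2))

lemma smooth_on_has_derivative: "smooth_on S f \<Longrightarrow> x \<in> S \<Longrightarrow> (f has_derivative fderiv f x) (at x)"
  by (intro has_fderiv smooth_on_differentiable)

lemma smooth_on_fderiv: "smooth_on S f \<Longrightarrow> smooth_on S (\<lambda>x. fderiv f x v)"
  unfolding smooth_on_def by (metis Ck_on.simps(2))

lemma smooth_on_continuous_on: "smooth_on S f \<Longrightarrow> continuous_on S f"
  unfolding smooth_on_def by (metis Ck_on.simps(1))

lemma smooth_on_cong:
  "smooth_on S f \<Longrightarrow> open S \<Longrightarrow> (\<And>x. x \<in> S \<Longrightarrow> f x = g x) \<Longrightarrow> smooth_on S g"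
  unfolding smooth_on_def using Ck_on_cong by blast

lemma smooth_on_subset: "smooth_on S f \<Longrightarrow> T \<subseteq> S \<Longrightarrow> smooth_on T f"
  unfolding smooth_on_def using Ck_on_subset by blast

lemma smooth_on_const [simp]: "smooth_on S (\<lambda>x. c)"
  unfolding smooth_on_def using Ck_on_const by blast

lemma smooth_on_bounded_linear:
  "bounded_linear h \<Longrightarrow> open S \<Longrightarrow> smooth_on S f \<Longrightarrow> smooth_on S (\<lambda>x. h (f x))"
  unfolding smooth_on_def using Ck_on_bounded_linear by blast

lemma smooth_on_bounded_bilinear:
  "bounded_bilinear h \<Longrightarrow> open S \<Longrightarrow> smooth_on S f \<Longrightarrow> smooth_on S g \<Longrightarrow> smooth_on S (\<lambda>x. h (f x) (g x))"
  unfolding smooth_on_def using Ck_on_bounded_bilinear by blast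

lemma smooth_on_add: "open S \<Longrightarrow> smooth_on S f \<Longrightarrow> smooth_on S g \<Longrightarrow> smooth_on S (\<lambda>x. f x + g x)"
  unfolding smooth_on_def using Ck_on_add by blast

lemmas smooth_on_scaleR = smooth_on_bounded_bilinear[OF bounded_bilinear_scaleR]
lemmas smooth_on_inner_left = smooth_on_bounded_linear[OF bounded_linear_inner_left]
lemmas smooth_on_minus = smooth_on_bounded_linear[OF bounded_linear_minus[OF bounded_linear_ident]]

lemma smooth_on_diff: "open S \<Longrightarrow> smooth_on S f \<Longrightarrow> smooth_on S g \<Longrightarrow> smooth_on S (\<lambda>x. f x - g x)"
  using smooth_on_add[of S f "\<lambda>x. - g x"] smooth_on_minus[of S g] by simp

lemma smooth_on_sum:
  "open S \<Longrightarrow> (\<And>i. i \<in> I \<Longrightarrow> smooth_on S (f i)) \<Longrightarrow> smooth_on S (\<lambda>x. \<Sum>i\<in>I. f i x)"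
  by (induction I rule: infinite_finite_induct) (auto intro!: smooth_on_add)

lemma linear_sum_Basis:
  fixes v :: "'a::euclidean_space"
  assumes "linear h"
  shows "h v = (\<Sum>b\<in>Basis. (v \<bullet> b) *\<^sub>R h b)"
  using assms by (metis (mono_tags, lifting) euclidean_representation linear_scale linear_sum sum.cong)

lemma linear_fderiv: "f differentiable (at x) \<Longrightarrow> linear (fderiv f x)"
  by (rule linear_frechet_derivative)

text \<open>\<open>Ck_on\<close> controls derivatives in fixed directions only, whereas the chain
  rule differentiates \<open>g\<close> in the moving direction \<open>fderiv f x v\<close>.
  Expanding that direction over the finite \<open>Basis\<close> gives scalar factors times
  derivatives of \<open>g\<close> in fixed directions, to which the induction hypothesis
  applies.\<close>

lemma Ck_on_compose:
  fixes f :: "'a::real_normed_vector \<Rightarrow> 'b::euclidean_space" and g :: "'b \<Rightarrow> 'c::real_normed_vector"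
  assumes "open S" "f ` S \<subseteq> T" "Ck_on k T g" "Ck_on k S f"
  shows "Ck_on k S (\<lambda>x. g (f x))"
  using assms(3,4)
proof (induction k arbitrary: g)
  case 0
  then show ?case using continuous_on_compose2[of T g S f] assms(2) by auto
next
  case (Suc k)
  have dg: "g differentiable (at (f x))" if "x \<in> S" for x
    using that Suc.prems assms(2) by auto
  have d: "((\<lambda>x. g (f x)) has_derivative (\<lambda>v. fderiv g (f x) (fderiv f x v))) (at x)" if "x \<in> S" for x
    using that Suc.prems(2) by (auto intro!: has_derivative_compose[of f _ x UNIV g] has_fderiv dg)
  have "Ck_on k S (\<lambda>x. fderiv (\<lambda>x. g (f x)) x v)" for v
  proof (rule Ck_on_cong[OF assms(1)])
    have "Ck_on k S (\<lambda>x. (fderiv f x v \<bullet> b) *\<^sub>R fderiv g (f x) b)" for b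
    proof (rule Ck_on_bounded_bilinear[OF assms(1) bounded_bilinear_scaleR])
      show "Ck_on k S (\<lambda>x. fderiv f x v \<bullet> b)"
        using Suc.prems by (intro Ck_on_bounded_linear[OF assms(1) bounded_linear_inner_left]) simp
      show "Ck_on k S (\<lambda>x. fderiv g (f x) b)"
        using Suc.prems by (intro Suc.IH) (auto intro: Ck_on_SucD)
    qed
    moreover have "Ck_on k S (\<lambda>x. \<Sum>b\<in>B. h b x)" if "\<And>b. Ck_on k S (h b)" for B and h :: "'b \<Rightarrow> 'a \<Rightarrow> 'c"
      using that
      by (induction B rule: infinite_finite_induct) (auto intro!: Ck_on_const Ck_on_add[OF assms(1)])
    ultimately show "Ck_on k S (\<lambda>x. \<Sum>b\<in>Basis. (fderiv f x v \<bullet> b) *\<^sub>R fderiv g (f x) b)" by simp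
    show "(\<Sum>b\<in>Basis. (fderiv f x v \<bullet> b) *\<^sub>R fderiv g (f x) b) = fderiv (\<lambda>x. g (f x)) x v"
      if "x \<in> S" for x
      unfolding fderiv_eqI[OF d[OF that]]
      by (rule linear_sum_Basis[OF linear_fderiv[OF dg[OF that]], symmetric])
  qed
  with d show ?case by (auto simp: differentiable_def)
qed

lemma smooth_on_compose:
  fixes f :: "'a::real_normed_vector \<Rightarrow> 'b::euclidean_space"
  shows "smooth_on T g \<Longrightarrow> smooth_on S f \<Longrightarrow> open S \<Longrightarrow> f ` S \<subseteq> T \<Longrightarrow> smooth_on S (\<lambda>x. g (f x))"
  unfolding smooth_on_def using Ck_on_compose by blast

text \<open>Serves to normalise vectors with exponent -1/2. Differentiation lowers the exponent,
  hence the induction over the order for all \<open>a\<close> at once.\<close>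

lemma smooth_on_powr: "smooth_on {0<..} (\<lambda>t::real. t powr a)"
proof -
  have "Ck_on k {0<..} (\<lambda>t::real. t powr a)" for k
  proof (induction k arbitrary: a)
    case 0
    have "continuous_on {0<..} (\<lambda>t::real. t powr a)"
      by (rule continuous_on_powr) (auto intro: continuous_on_id continuous_on_const)
    then show ?case by simp
  next
    case (Suc k)
    have d: "((\<lambda>t. t powr a) has_derivative (\<lambda>v. (v * a) * t powr (a - 1))) (at t)" if "t > 0" for t :: real
      using has_real_derivative_powr[OF that, of a]
      by (rule has_derivative_eq_rhs[OF has_field_derivative_imp_has_derivative]) (auto simp: mult_ac)
    have "Ck_on k {0<..} (\<lambda>t. fderiv (\<lambda>t. t powr a) t v)" for v
    proof (rule Ck_on_cong)
      show "Ck_on k {0<..} (\<lambda>t. (v * a) * t powr (a - 1))"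
        by (rule Ck_on_bounded_linear[OF _ bounded_linear_mult_right Suc.IH]) simp
      show "(v * a) * t powr (a - 1) = fderiv (\<lambda>t. t powr a) t v" if "t \<in> {0<..}" for t :: real
        using fderiv_eqI[OF d, of t] that by (metis greaterThan_iff)
    qed simp
    with d show ?case by (auto simp: differentiable_def)
  qed
  then show ?thesis by (simp add: smooth_on_def)
qed

section \<open>Linear and bilinear maps depending on a point\<close>

lemma smooth_on_linear_family:
  fixes L :: "'a::real_normed_vector \<Rightarrow> 'b::euclidean_space \<Rightarrow> 'c::real_normed_vector"
  assumes "open S" "\<And>x. x \<in> S \<Longrightarrow> linear (L x)" "\<And>v. smooth_on S (\<lambda>x. L x v)" "smooth_on S a"
  shows "smooth_on S (\<lambda>x. L x (a x))"
proof (rule smooth_on_cong[OF _ \<open>open S\<close>])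
  show "smooth_on S (\<lambda>x. \<Sum>b\<in>Basis. (a x \<bullet> b) *\<^sub>R L x b)"
    using assms by (intro smooth_on_sum smooth_on_scaleR smooth_on_inner_left) auto
  show "(\<Sum>b\<in>Basis. (a x \<bullet> b) *\<^sub>R L x b) = L x (a x)" if "x \<in> S" for x
    by (rule linear_sum_Basis[OF assms(2)[OF that], symmetric])
qed

text \<open>The product rule for evaluating a varying linear map at a varying vector, such as
  \<open>fderiv Z y (Y y)\<close>. Only derivatives with a frozen argument are given, so everything
  is expanded over \<open>Basis\<close>; a second expansion, with \<open>a x\<close> held fixed,
  recognises the first summand.\<close>

lemma has_derivative_linear_family:
  fixes L :: "'a::real_normed_vector \<Rightarrow> 'b::euclidean_space \<Rightarrow> 'c::real_normed_vector"
  assumes "open S" "x \<in> S" "\<And>x. x \<in> S \<Longrightarrow> linear (L x)"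
    "\<And>v. (\<lambda>x. L x v) differentiable (at x)" "(a has_derivative a') (at x)"
  shows "((\<lambda>x. L x (a x)) has_derivative (\<lambda>u. fderiv (\<lambda>y. L y (a x)) x u + L x (a' u))) (at x)"
proof -
  note D = has_fderiv[OF assms(4)] and rep = linear_sum_Basis[OF assms(3)]
  have "((\<lambda>y. \<Sum>b\<in>Basis. (a y \<bullet> b) *\<^sub>R L y b) has_derivative
      (\<lambda>u. \<Sum>b\<in>Basis. (a x \<bullet> b) *\<^sub>R fderiv (\<lambda>x. L x b) x u + (a' u \<bullet> b) *\<^sub>R L x b)) (at x)"
    by (intro has_derivative_sum has_derivative_scaleR has_derivative_inner_left D assms(5))
  then have 1: "((\<lambda>y. L y (a y)) has_derivative
      (\<lambda>u. \<Sum>b\<in>Basis. (a x \<bullet> b) *\<^sub>R fderiv (\<lambda>x. L x b) x u + (a' u \<bullet> b) *\<^sub>R L x b)) (at x)"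
    by (rule has_derivative_transform_within_open[OF _ assms(1,2)]) (rule rep[symmetric])
  have "((\<lambda>y. \<Sum>b\<in>Basis. (a x \<bullet> b) *\<^sub>R L y b) has_derivative
      (\<lambda>u. \<Sum>b\<in>Basis. (a x \<bullet> b) *\<^sub>R fderiv (\<lambda>x. L x b) x u)) (at x)"
    by (intro has_derivative_sum has_derivative_scaleR_right D)
  then have "((\<lambda>y. L y (a x)) has_derivative
      (\<lambda>u. \<Sum>b\<in>Basis. (a x \<bullet> b) *\<^sub>R fderiv (\<lambda>x. L x b) x u)) (at x)"
    by (rule has_derivative_transform_within_open[OF _ assms(1,2)]) (rule rep[symmetric])
  then have "fderiv (\<lambda>y. L y (a x)) x u = (\<Sum>b\<in>Basis. (a x \<bullet> b) *\<^sub>R fderiv (\<lambda>x. L x b) x u)" for u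
    by (simp only: fderiv_eqI)
  moreover have "L x (a' u) = (\<Sum>b\<in>Basis. (a' u \<bullet> b) *\<^sub>R L x b)" for u
    by (rule rep[OF assms(2)])
  ultimately show ?thesis
    using 1 by (simp only: sum.distrib)
qed

lemma linear_fderiv_family:
  fixes L :: "'a::real_normed_vector \<Rightarrow> 'b::real_normed_vector \<Rightarrow> 'c::real_normed_vector"
  assumes "open S" "x \<in> S" "\<And>x. x \<in> S \<Longrightarrow> linear (L x)" "\<And>v. (\<lambda>x. L x v) differentiable (at x)"
  shows "linear (\<lambda>v. fderiv (\<lambda>x. L x v) x u)"
proof (rule linearI)
  note D = has_fderiv[OF assms(4)]
  fix v w :: 'b and c :: real
  have "((\<lambda>x. L x (v + w)) has_derivative (\<lambda>u. fderiv (\<lambda>x. L x v) x u + fderiv (\<lambda>x. L x w) x u)) (at x)"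
    by (rule has_derivative_transform_within_open[OF has_derivative_add[OF D[of v] D[of w]] assms(1,2)])
      (simp add: linear_add[OF assms(3)])
  then show "fderiv (\<lambda>x. L x (v + w)) x u = fderiv (\<lambda>x. L x v) x u + fderiv (\<lambda>x. L x w) x u"
    by (simp add: fderiv_eqI)
  have "((\<lambda>x. L x (c *\<^sub>R v)) has_derivative (\<lambda>u. c *\<^sub>R fderiv (\<lambda>x. L x v) x u)) (at x)"
    by (rule has_derivative_transform_within_open[OF has_derivative_scaleR_right[OF D[of v], of c] assms(1,2)])
      (simp add: linear_scale[OF assms(3)])
  then show "fderiv (\<lambda>x. L x (c *\<^sub>R v)) x u = c *\<^sub>R fderiv (\<lambda>x. L x v) x u"
    by (simp add: fderiv_eqI)
qed

lemma smooth_on_bilinear_family: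
  fixes B :: "'a::real_normed_vector \<Rightarrow> 'b::euclidean_space \<Rightarrow> 'c::euclidean_space \<Rightarrow> 'd::real_normed_vector"
  assumes "open S" and B: "\<And>x. x \<in> S \<Longrightarrow> bilinear (B x)" and "\<And>v w. smooth_on S (\<lambda>x. B x v w)"
    "smooth_on S a" "smooth_on S b"
  shows "smooth_on S (\<lambda>x. B x (a x) (b x))"
proof (rule smooth_on_linear_family[OF assms(1) _ _ assms(4), where L = "\<lambda>x v. B x v (b x)"])
  show "linear (\<lambda>v. B x v (b x))" if "x \<in> S" for x
    using B[OF that] by (simp add: bilinear_def)
  show "smooth_on S (\<lambda>x. B x v (b x))" for v
  proof (rule smooth_on_linear_family[where L = "\<lambda>x. B x v"])
    show "linear (B x v)" if "x \<in> S" for x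
      using B[OF that] by (simp add: bilinear_def)
  qed (rule assms)+
qed

text \<open>Two applications of the linear rule: first in the last slot with the first argument
  frozen, then in the first slot with the moving \<open>b\<close> absorbed into the linear
  map.\<close>

lemma has_derivative_bilinear_family:
  fixes B :: "'a::real_normed_vector \<Rightarrow> 'b::euclidean_space \<Rightarrow> 'c::euclidean_space \<Rightarrow> 'd::real_normed_vector"
  assumes "open S" "x \<in> S" and B: "\<And>x. x \<in> S \<Longrightarrow> bilinear (B x)"
    and "\<And>v w. (\<lambda>x. B x v w) differentiable (at x)"
    "(a has_derivative a') (at x)" "(b has_derivative b') (at x)"
  shows "((\<lambda>x. B x (a x) (b x)) has_derivative
    (\<lambda>u. fderiv (\<lambda>y. B y (a x) (b x)) x u + B x (a' u) (b x) + B x (a x) (b' u))) (at x)"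
proof -
  have 1: "((\<lambda>y. B y v (b y)) has_derivative (\<lambda>u. fderiv (\<lambda>y. B y v (b x)) x u + B x v (b' u))) (at x)" for v
  proof (rule has_derivative_linear_family[where L = "\<lambda>x. B x v" and S = S])
    show "linear (B x v)" if "x \<in> S" for x
      using B[OF that] by (simp add: bilinear_def)
  qed (rule assms)+
  have "((\<lambda>y. B y (a y) (b y)) has_derivative
     (\<lambda>u. fderiv (\<lambda>y. B y (a x) (b y)) x u + B x (a' u) (b x))) (at x)"
  proof (rule has_derivative_linear_family[where L = "\<lambda>x v. B x v (b x)" and S = S])
    show "linear (\<lambda>v. B x v (b x))" if "x \<in> S" for x
      using B[OF that] by (simp add: bilinear_def)
    show "(\<lambda>y. B y v (b y)) differentiable (at x)" for v
      by (rule differentiableI[OF 1])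
  qed (rule assms)+
  moreover have "fderiv (\<lambda>y. B y (a x) (b y)) x u + B x (a' u) (b x)
      = fderiv (\<lambda>y. B y (a x) (b x)) x u + B x (a' u) (b x) + B x (a x) (b' u)" for u
    unfolding fderiv_eqI[OF 1] by simp
  ultimately show ?thesis by simp
qed

lemma bilinear_fderiv_family:
  fixes B :: "'a::real_normed_vector \<Rightarrow> 'b::real_normed_vector \<Rightarrow> 'c::real_normed_vector \<Rightarrow> 'd::real_normed_vector"
  assumes "open S" "x \<in> S" and B: "\<And>x. x \<in> S \<Longrightarrow> bilinear (B x)"
    and "\<And>v w. (\<lambda>x. B x v w) differentiable (at x)"
  shows "bilinear (\<lambda>v w. fderiv (\<lambda>x. B x v w) x u)"
  unfolding bilinear_def
proof (intro conjI allI)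
  show "linear (\<lambda>w. fderiv (\<lambda>x. B x v w) x u)" for v
    using B by (intro linear_fderiv_family[where L = "\<lambda>x. B x v" and S = S] assms) (simp_all add: bilinear_def)
  show "linear (\<lambda>v. fderiv (\<lambda>x. B x v w) x u)" for w
    using B by (intro linear_fderiv_family[where L = "\<lambda>x v. B x v w" and S = S] assms) (simp_all add: bilinear_def)
qed

text \<open>The left-hand side is symmetric in \<open>v\<close> and \<open>w\<close>, so the two orders of differentiation have
  a common value arbitrarily close to \<open>x\<close>.\<close>

lemma second_difference_mvt:
  fixes f :: "'a::real_normed_vector \<Rightarrow> real"
  assumes f: "\<And>y. y \<in> S \<Longrightarrow> f differentiable (at y)"
    and f2: "\<And>y. y \<in> S \<Longrightarrow> (\<lambda>z. fderiv f z v) differentiable (at y)"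
    and h: "h > 0" and S: "\<And>s t. 0 \<le> s \<Longrightarrow> s \<le> h \<Longrightarrow> 0 \<le> t \<Longrightarrow> t \<le> h \<Longrightarrow> x + s *\<^sub>R v + t *\<^sub>R w \<in> S"
  obtains s t where "0 \<le> s" "s \<le> h" "0 \<le> t" "t \<le> h"
    "f (x + h *\<^sub>R v + h *\<^sub>R w) - f (x + h *\<^sub>R v) - f (x + h *\<^sub>R w) + f x
      = h * h * fderiv (\<lambda>z. fderiv f z v) (x + s *\<^sub>R v + t *\<^sub>R w) w"
proof -
  have lin: "linear (fderiv f y)" "linear (fderiv (\<lambda>z. fderiv f z v) y)" if "y \<in> S" for y
    using that f f2 by (auto intro: linear_fderiv)
  \<comment> \<open>The first difference in direction \<open>w\<close>. The mean value theorem in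
    \<open>s\<close> turns its increment into a difference of derivatives along \<open>v\<close>,
    and a second application in \<open>t\<close> turns that into a mixed second derivative.\<close>
  define \<phi> where "\<phi> s = f (x + s *\<^sub>R v + h *\<^sub>R w) - f (x + s *\<^sub>R v)" for s
  have S0: "x + s *\<^sub>R v \<in> S" if "0 \<le> s" "s \<le> h" for s using S[of s 0] that h by simp
  have "(\<phi> has_real_derivative fderiv f (x + s *\<^sub>R v + h *\<^sub>R w) v - fderiv f (x + s *\<^sub>R v) v) (at s)"
    if "0 \<le> s" "s \<le> h" for s
  proof -
    have D: "((\<lambda>s. f (x + s *\<^sub>R v + a)) has_derivative (\<lambda>r. fderiv f (x + s *\<^sub>R v + a) (r *\<^sub>R v))) (at s)"
      if "x + s *\<^sub>R v + a \<in> S" for a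
      by (rule has_derivative_compose[where g = f and f = "\<lambda>s. x + s *\<^sub>R v + a", OF _ has_fderiv[OF f[OF that]]])
        (auto intro!: derivative_eq_intros)
    have m: "x + s *\<^sub>R v + h *\<^sub>R w \<in> S" "x + s *\<^sub>R v \<in> S"
      using S[of s h] S0[of s] that h by auto
    then have "((\<lambda>s. f (x + s *\<^sub>R v + h *\<^sub>R w) - f (x + s *\<^sub>R v + 0)) has_derivative
        (\<lambda>r. fderiv f (x + s *\<^sub>R v + h *\<^sub>R w) (r *\<^sub>R v) - fderiv f (x + s *\<^sub>R v + 0) (r *\<^sub>R v))) (at s)"
      by (intro has_derivative_diff D) simp_all
    moreover have "fderiv f (x + s *\<^sub>R v + h *\<^sub>R w) (r *\<^sub>R v) - fderiv f (x + s *\<^sub>R v + 0) (r *\<^sub>R v)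
        = (fderiv f (x + s *\<^sub>R v + h *\<^sub>R w) v - fderiv f (x + s *\<^sub>R v) v) * r" for r
      by (simp add: linear_scale[OF lin(1)[OF m(1)]] linear_scale[OF lin(1)[OF m(2)]] left_diff_distrib mult.commute right_diff_distrib)
    ultimately show ?thesis
      unfolding \<phi>_def has_field_derivative_def by simp
  qed
  from MVT2[OF h this] obtain s where s: "0 < s" "s < h"
    and eq1: "\<phi> h - \<phi> 0 = h * (fderiv f (x + s *\<^sub>R v + h *\<^sub>R w) v - fderiv f (x + s *\<^sub>R v) v)"
    by auto
  have "((\<lambda>t. fderiv f (x + s *\<^sub>R v + t *\<^sub>R w) v) has_real_derivative
      fderiv (\<lambda>z. fderiv f z v) (x + s *\<^sub>R v + t *\<^sub>R w) w) (at t)" if "0 \<le> t" "t \<le> h" for t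
  proof -
    have m: "x + s *\<^sub>R v + t *\<^sub>R w \<in> S" using S s that by simp
    have "((\<lambda>t. fderiv f (x + s *\<^sub>R v + t *\<^sub>R w) v) has_derivative
        (\<lambda>r. fderiv (\<lambda>z. fderiv f z v) (x + s *\<^sub>R v + t *\<^sub>R w) (r *\<^sub>R w))) (at t)"
      by (rule has_derivative_compose[where g = "\<lambda>z. fderiv f z v" and f = "\<lambda>t. x + s *\<^sub>R v + t *\<^sub>R w", OF _ has_fderiv[OF f2[OF m]]]) (auto intro!: derivative_eq_intros)
    then show ?thesis
      unfolding has_field_derivative_def by (simp add: lin[OF m] linear_scale mult_commute_abs)
  qed
  from MVT2[OF h this] obtain t where t: "0 < t" "t < h" and
    "fderiv f (x + s *\<^sub>R v + h *\<^sub>R w) v - fderiv f (x + s *\<^sub>R v + 0 *\<^sub>R w) v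
      = h * fderiv (\<lambda>z. fderiv f z v) (x + s *\<^sub>R v + t *\<^sub>R w) w"
    by auto
  with eq1 show ?thesis using s t by (intro that[of s t]) (auto simp: \<phi>_def)
qed

lemma fderiv_fderiv_commute_real:
  fixes f :: "'a::real_normed_vector \<Rightarrow> real"
  assumes "open S" "x \<in> S" "smooth_on S f"
  shows "fderiv (\<lambda>z. fderiv f z v) x w = fderiv (\<lambda>z. fderiv f z w) x v"
proof (rule ccontr)
  define F where "F v w y = fderiv (\<lambda>z. fderiv f z v) y w" for v w y
  assume "fderiv (\<lambda>z. fderiv f z v) x w \<noteq> fderiv (\<lambda>z. fderiv f z w) x v"
  \<comment> \<open>Half the supposed gap: two equal numbers cannot each lie within less than half
    the gap of the two distinct values.\<close>
  then have e: "\<bar>F v w x - F w v x\<bar> / 2 > 0" (is "?e > 0") by (simp add: F_def)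
  have smF: "smooth_on S (F v w)" for v w
    unfolding F_def using assms(3) by (intro smooth_on_fderiv)
  then have "isCont (F v w) x" for v w
    using assms(1,2) smooth_on_continuous_on continuous_on_eq_continuous_at by blast
  then have "\<exists>d>0. \<forall>y. dist y x < d \<longrightarrow> dist (F v w y) (F v w x) < ?e" for v w
    using e unfolding continuous_at_eps_delta by blast
  then obtain d1 d2 where d: "d1 > 0" "d2 > 0"
    "\<And>y. dist y x < d1 \<Longrightarrow> \<bar>F v w y - F v w x\<bar> < ?e"
    "\<And>y. dist y x < d2 \<Longrightarrow> \<bar>F w v y - F w v x\<bar> < ?e"
    unfolding dist_real_def by metis
  obtain d3 where d3: "d3 > 0" "ball x d3 \<subseteq> S"
    using assms(1,2) openE by blast
  define d where "d = Min {d1, d2, d3}"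
  have dpos: "d > 0" using d d3 by (simp add: d_def)
  \<comment> \<open>Every point of the parallelogram with parameters up to \<open>h\<close> is then
    closer than \<open>d\<close> to \<open>x\<close>; the summand 1 keeps the denominator positive
    when \<open>v\<close> and \<open>w\<close> both vanish.\<close>
  define h where "h = d / (norm v + norm w + 1)"
  have h: "h > 0" using dpos by (simp add: h_def add_nonneg_pos)
  have near: "dist (x + s *\<^sub>R a + t *\<^sub>R b) x < d"
    if "0 \<le> s" "s \<le> h" "0 \<le> t" "t \<le> h" "norm a + norm b = norm v + norm w" for s t a b
  proof -
    have "dist (x + s *\<^sub>R a + t *\<^sub>R b) x \<le> s * norm a + t * norm b"
      unfolding dist_norm using norm_triangle_ineq[of "s *\<^sub>R a" "t *\<^sub>R b"] that by simp
    also have "\<dots> \<le> h * norm a + h * norm b" using that by (intro add_mono mult_right_mono) auto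
    also have "\<dots> = h * (norm v + norm w)" using that by (simp flip: distrib_left)
    also have "\<dots> < h * (norm v + norm w + 1)" using h by simp
    also have "\<dots> = d" by (simp add: h_def add_nonneg_pos less_imp_neq[symmetric])
    finally show ?thesis .
  qed
  have inS: "y \<in> S" if "dist y x < d" for y
    using that d3 by (auto simp: d_def dist_commute)
  have F: "f differentiable (at y)" "(\<lambda>z. fderiv f z a) differentiable (at y)" if "y \<in> S" for y a
    using that assms(3) smooth_on_differentiable smooth_on_fderiv by blast+
  have S: "x + s *\<^sub>R a + t *\<^sub>R b \<in> S"
    if "norm a + norm b = norm v + norm w" "0 \<le> s" "s \<le> h" "0 \<le> t" "t \<le> h" for s t a b
    by (intro inS near that)
  obtain s t where st: "0 \<le> s" "s \<le> h" "0 \<le> t" "t \<le> h"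
    and "f (x + h *\<^sub>R v + h *\<^sub>R w) - f (x + h *\<^sub>R v) - f (x + h *\<^sub>R w) + f x
      = h * h * F v w (x + s *\<^sub>R v + t *\<^sub>R w)"
    unfolding F_def using second_difference_mvt[OF F h S[OF refl]] by blast
  moreover obtain s' t' where st': "0 \<le> s'" "s' \<le> h" "0 \<le> t'" "t' \<le> h"
    and "f (x + h *\<^sub>R w + h *\<^sub>R v) - f (x + h *\<^sub>R w) - f (x + h *\<^sub>R v) + f x
      = h * h * F w v (x + s' *\<^sub>R w + t' *\<^sub>R v)"
    unfolding F_def using second_difference_mvt[OF F h S[OF add.commute]] by blast
  ultimately have "F v w (x + s *\<^sub>R v + t *\<^sub>R w) = F w v (x + s' *\<^sub>R w + t' *\<^sub>R v)"
    using h by (simp add: algebra_simps)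
  moreover have "\<bar>F v w (x + s *\<^sub>R v + t *\<^sub>R w) - F v w x\<bar> < ?e"
    using near[OF st, of v w] d(3) by (simp add: d_def)
  moreover have "\<bar>F w v (x + s' *\<^sub>R w + t' *\<^sub>R v) - F w v x\<bar> < ?e"
    using near[OF st', of w v] d(4) by (simp add: d_def)
  ultimately show False by (smt (verit) field_sum_of_halves)
qed

text \<open>The mean value argument is scalar, so the vector case is reduced to the components
  \<open>f z \<bullet> b\<close>.\<close>

lemma fderiv_fderiv_commute:
  fixes f :: "'a::real_normed_vector \<Rightarrow> 'b::euclidean_space"
  assumes "open S" "x \<in> S" "smooth_on S f"
  shows "fderiv (\<lambda>z. fderiv f z v) x w = fderiv (\<lambda>z. fderiv f z w) x v"
proof (rule euclidean_eqI)
  fix b :: 'b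
  have 1: "fderiv (\<lambda>z. f z \<bullet> b) y = (\<lambda>v. fderiv f y v \<bullet> b)" if "y \<in> S" for y
    by (intro fderiv_eqI has_derivative_inner_left smooth_on_has_derivative[OF assms(3) that])
  have 2: "fderiv (\<lambda>z. fderiv (\<lambda>z. f z \<bullet> b) z v) x = (\<lambda>w. fderiv (\<lambda>z. fderiv f z v) x w \<bullet> b)" for v
  proof (rule fderiv_eqI)
    have "((\<lambda>z. fderiv f z v \<bullet> b) has_derivative (\<lambda>w. fderiv (\<lambda>z. fderiv f z v) x w \<bullet> b)) (at x)"
      by (intro has_derivative_inner_left smooth_on_has_derivative[OF smooth_on_fderiv[OF assms(3)] assms(2)])
    then show "((\<lambda>z. fderiv (\<lambda>z. f z \<bullet> b) z v) has_derivative
        (\<lambda>w. fderiv (\<lambda>z. fderiv f z v) x w \<bullet> b)) (at x)"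
      by (rule has_derivative_transform_within_open[OF _ assms(1,2)]) (simp add: 1)
  qed
  have "smooth_on S (\<lambda>z. f z \<bullet> b)" using assms by (intro smooth_on_inner_left)
  from fderiv_fderiv_commute_real[OF assms(1,2) this, of v w]
  show "fderiv (\<lambda>z. fderiv f z v) x w \<bullet> b = fderiv (\<lambda>z. fderiv f z w) x v \<bullet> b"
    by (simp add: 2)
qed

section \<open>Traces and orthonormal bases\<close>

abbreviation tr :: "(real ^ 'n \<Rightarrow> real ^ 'n::finite) \<Rightarrow> real" where
  "tr f \<equiv> trace (matrix f)"

lemma tr_eq: "tr f = (\<Sum>i\<in>UNIV. f (axis i 1) $ i)"
  by (simp add: trace_def matrix_def)

text \<open>Used twice: to cancel the Christoffel terms when a covariant derivative is traced, and
  to see that the Ricci trace does not depend on the chart.\<close>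

lemma tr_compose_commute:
  fixes f g :: "real ^ 'n \<Rightarrow> real ^ 'n::finite"
  assumes "linear f" "linear g"
  shows "tr (\<lambda>v. f (g v)) = tr (\<lambda>v. g (f v))"
proof -
  have "tr (f \<circ> g) = tr (g \<circ> f)"
    unfolding matrix_compose[OF assms(2,1)] matrix_compose[OF assms] by (rule trace_mul_sym)
  then show ?thesis by (simp only: o_def)
qed

lemma tr_add: "tr (\<lambda>v. f v + g v) = tr f + tr g"
  by (simp add: tr_eq sum.distrib)

lemma tr_diff: "tr (\<lambda>v. f v - g v) = tr f - tr g"
  by (simp add: tr_eq sum_subtractf)

text \<open>Indexing \<open>E\<close> by \<open>'n\<close> makes the number of vectors equal to the
  dimension, so orthonormality alone forces \<open>E\<close> to span.\<close>

locale orthonormal_basis =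
  fixes B :: "real ^ 'n \<Rightarrow> real ^ 'n::finite \<Rightarrow> real" and E :: "'n \<Rightarrow> real ^ 'n"
  assumes bilinear_B: "bilinear B"
    and commute_B: "B v w = B w v"
    and orthonormal: "B (E i) (E j) = (if i = j then 1 else 0)"
begin

lemma coefficient: "B (\<Sum>i\<in>UNIV. c i *\<^sub>R E i) (E j) = c j"
proof -
  interpret L: linear "\<lambda>v. B v (E j)" using bilinear_B by (simp add: bilinear_def)
  show ?thesis by (simp add: L.sum L.scale orthonormal if_distrib cong: if_cong)
qed

text \<open>By \<open>coefficient\<close>, a linear combination determines its coefficients, so the
  combination map \<open>L\<close> is injective, hence surjective for reasons of dimension.\<close>

lemma expand: "v = (\<Sum>i\<in>UNIV. B v (E i) *\<^sub>R E i)"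
proof -
  define L where "L c = (\<Sum>i\<in>UNIV. (c $ i) *\<^sub>R E i)" for c :: "real ^ 'n"
  have "linear L"
    unfolding L_def by (rule linearI) (simp_all add: scaleR_add_left sum.distrib scaleR_sum_right)
  moreover have "inj L"
    by (rule inj_on_inverseI[where g = "\<lambda>v. \<chi> i. B v (E i)"]) (simp add: L_def coefficient vec_eq_iff)
  ultimately have "surj L" by (rule linear_inj_imp_surj)
  then obtain c where "v = L c" by blast
  then show ?thesis by (simp add: L_def coefficient)
qed

lemma tr_conv:
  assumes "linear f"
  shows "tr f = (\<Sum>i\<in>UNIV. B (f (E i)) (E i))"
proof -
  interpret f: linear f by fact
  have "tr f = (\<Sum>k\<in>UNIV. \<Sum>i\<in>UNIV. B (axis k 1) (E i) * f (E i) $ k)"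
    unfolding tr_eq
  proof (rule sum.cong[OF refl])
    fix k
    have "f (axis k 1) = (\<Sum>i\<in>UNIV. B (axis k 1) (E i) *\<^sub>R f (E i))"
      by (subst expand[of "axis k 1"]) (simp add: f.sum f.scale)
    then show "f (axis k 1) $ k = (\<Sum>i\<in>UNIV. B (axis k 1) (E i) * f (E i) $ k)" by simp
  qed
  also have "\<dots> = (\<Sum>i\<in>UNIV. \<Sum>k\<in>UNIV. B (axis k 1) (E i) * f (E i) $ k)"
    by (rule sum.swap)
  also have "\<dots> = (\<Sum>i\<in>UNIV. B (f (E i)) (E i))"
  proof (rule sum.cong[OF refl])
    fix i
    interpret L: linear "\<lambda>v. B v (E i)" using bilinear_B by (simp add: bilinear_def)
    have "B (f (E i)) (E i) = B (\<Sum>k\<in>UNIV. (f (E i) $ k) *\<^sub>R axis k 1) (E i)"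
      using basis_expansion[of "f (E i)"] by (simp add: scalar_mult_eq_scaleR)
    then show "(\<Sum>k\<in>UNIV. B (axis k 1) (E i) * f (E i) $ k) = B (f (E i)) (E i)"
      by (simp add: L.sum L.scale mult.commute)
  qed
  finally show ?thesis .
qed

lemma contract_expand:
  fixes C :: "real ^ 'n \<Rightarrow> real ^ 'n \<Rightarrow> real"
  assumes "bilinear C"
  shows "(\<Sum>i\<in>UNIV. C (a i) (b i)) = (\<Sum>i\<in>UNIV. \<Sum>j\<in>UNIV. B (a i) (E j) * C (E j) (b i))"
proof (rule sum.cong[OF refl])
  fix i
  interpret L: linear "\<lambda>v. C v (b i)" using assms by (simp add: bilinear_def)
  show "C (a i) (b i) = (\<Sum>j\<in>UNIV. B (a i) (E j) * C (E j) (b i))"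
    by (subst expand[of "a i"]) (simp add: L.sum L.scale)
qed

text \<open>An infinitesimal rotation of the frame does not change a trace: the matrix
  \<open>B (a i) (E j)\<close> is skew, so expanding each \<open>a i\<close> in the basis makes the
  two sums cancel after exchanging the indices.\<close>

lemma contract_skew:
  fixes C :: "real ^ 'n \<Rightarrow> real ^ 'n \<Rightarrow> real"
  assumes C: "bilinear C" and skew: "\<And>i j. B (a i) (E j) + B (E i) (a j) = 0"
  shows "(\<Sum>i\<in>UNIV. C (a i) (E i) + C (E i) (a i)) = 0"
proof -
  have C': "bilinear (\<lambda>v w. C w v)" using C by (simp add: bilinear_def)
  have skew': "B (a i) (E j) = - B (a j) (E i)" for i j
    using skew[of i j] commute_B[of "E i" "a j"] by simp
  have "(\<Sum>i\<in>UNIV. C (E i) (a i)) = (\<Sum>i\<in>UNIV. \<Sum>j\<in>UNIV. B (a i) (E j) * C (E i) (E j))"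
    using contract_expand[OF C', where a = a and b = E] .
  also have "\<dots> = (\<Sum>j\<in>UNIV. \<Sum>i\<in>UNIV. B (a i) (E j) * C (E i) (E j))"
    by (rule sum.swap)
  also have "\<dots> = - (\<Sum>i\<in>UNIV. \<Sum>j\<in>UNIV. B (a i) (E j) * C (E j) (E i))"
    unfolding sum_negf[symmetric] by (intro sum.cong refl) (subst skew', simp)
  also have "\<dots> = - (\<Sum>i\<in>UNIV. C (a i) (E i))"
    using contract_expand[OF C, where a = a and b = E] by simp
  finally show ?thesis by (simp add: sum.distrib)
qed

lemma contract_product:
  "(\<Sum>i\<in>UNIV. B v (E i) * B w (E i)) = B v w"
proof -
  interpret L: linear "B w" using bilinear_B by (simp add: bilinear_def)
  have "B w v = (\<Sum>i\<in>UNIV. B v (E i) * B w (E i))"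
    by (subst (1) expand[of v]) (simp add: L.sum L.scale)
  then show ?thesis using commute_B[of v w] by simp
qed

lemma contract_linear:
  fixes h :: "real ^ 'n \<Rightarrow> real"
  assumes "linear h"
  shows "(\<Sum>i\<in>UNIV. B v (E i) * h (E i)) = h v"
proof -
  interpret L: linear h by fact
  show ?thesis by (subst (2) expand[of v]) (simp add: L.sum L.scale)
qed

end

text \<open>Expanding \<open>E i\<close> in the basis \<open>F\<close> and then contracting over
  \<open>i\<close> reassembles \<open>F j\<close>.\<close>

lemma contract_basis_independent:
  fixes C :: "real ^ 'n \<Rightarrow> real ^ 'n::finite \<Rightarrow> real"
  assumes "orthonormal_basis B E" "orthonormal_basis B F" "bilinear C"
  shows "(\<Sum>i\<in>UNIV. C (E i) (E i)) = (\<Sum>i\<in>UNIV. C (F i) (F i))"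
proof -
  interpret E: orthonormal_basis B E by fact
  interpret F: orthonormal_basis B F by fact
  have "(\<Sum>i\<in>UNIV. C (E i) (E i)) = (\<Sum>i\<in>UNIV. \<Sum>j\<in>UNIV. B (E i) (F j) * C (F j) (E i))"
    by (rule F.contract_expand[OF assms(3)])
  also have "\<dots> = (\<Sum>j\<in>UNIV. \<Sum>i\<in>UNIV. B (F j) (E i) * C (F j) (E i))"
    by (subst sum.swap) (simp add: E.commute_B)
  also have "\<dots> = (\<Sum>j\<in>UNIV. C (F j) (F j))"
    using assms(3) by (simp add: E.contract_linear bilinear_def)
  finally show ?thesis .
qed

section \<open>Connections and metrics in a coordinate domain\<close>

text \<open>\<open>\<Gamma> x v w\<close> is the covariant derivative along \<open>v\<close> of the
  field with constant components \<open>w\<close>. Constant fields commute, so symmetry of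
  \<open>\<Gamma>\<close> is the vanishing of the torsion.\<close>

locale smooth_connection =
  fixes W :: "(real ^ 'n::finite) set" and \<Gamma> :: "real ^ 'n \<Rightarrow> real ^ 'n \<Rightarrow> real ^ 'n \<Rightarrow> real ^ 'n"
  assumes open_W: "open W"
    and bilinear_\<Gamma>: "x \<in> W \<Longrightarrow> bilinear (\<Gamma> x)"
    and smooth_\<Gamma>: "smooth_on W (\<lambda>x. \<Gamma> x v w)"
    and commute_\<Gamma>: "x \<in> W \<Longrightarrow> \<Gamma> x v w = \<Gamma> x w v"
begin

definition d\<Gamma> :: "real ^ 'n \<Rightarrow> real ^ 'n \<Rightarrow> real ^ 'n \<Rightarrow> real ^ 'n \<Rightarrow> real ^ 'n" where
  "d\<Gamma> x u v w = fderiv (\<lambda>y. \<Gamma> y v w) x u"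

text \<open>The commutator of the covariant derivatives along the constant fields \<open>u\<close>
  and \<open>v\<close>, applied to the constant field \<open>w\<close>; the bracket term of the
  curvature vanishes.\<close>

definition riem :: "real ^ 'n \<Rightarrow> real ^ 'n \<Rightarrow> real ^ 'n \<Rightarrow> real ^ 'n \<Rightarrow> real ^ 'n" where
  "riem x u v w = d\<Gamma> x u v w - d\<Gamma> x v u w + \<Gamma> x u (\<Gamma> x v w) - \<Gamma> x v (\<Gamma> x u w)"

definition cov_riem ::
    "real ^ 'n \<Rightarrow> real ^ 'n \<Rightarrow> real ^ 'n \<Rightarrow> real ^ 'n \<Rightarrow> real ^ 'n \<Rightarrow> real ^ 'n" where
  "cov_riem x a u v w = fderiv (\<lambda>y. riem y u v w) x a + \<Gamma> x a (riem x u v w)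
     - riem x (\<Gamma> x a u) v w - riem x u (\<Gamma> x a v) w - riem x u v (\<Gamma> x a w)"

definition ric :: "real ^ 'n \<Rightarrow> real ^ 'n \<Rightarrow> real ^ 'n \<Rightarrow> real" where
  "ric x v w = tr (\<lambda>u. riem x u v w)"

definition cov_ric :: "real ^ 'n \<Rightarrow> real ^ 'n \<Rightarrow> real ^ 'n \<Rightarrow> real ^ 'n \<Rightarrow> real" where
  "cov_ric x a v w = fderiv (\<lambda>y. ric y v w) x a - ric x (\<Gamma> x a v) w - ric x v (\<Gamma> x a w)"

lemma differentiable_\<Gamma>: "x \<in> W \<Longrightarrow> (\<lambda>y. \<Gamma> y v w) differentiable (at x)"
  by (rule smooth_on_differentiable[OF smooth_\<Gamma>])

lemma bilinear_d\<Gamma>: "x \<in> W \<Longrightarrow> bilinear (d\<Gamma> x u)"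
  unfolding d\<Gamma>_def by (rule bilinear_fderiv_family[OF open_W _ bilinear_\<Gamma> differentiable_\<Gamma>])

lemma linear_d\<Gamma>: "x \<in> W \<Longrightarrow> linear (\<lambda>u. d\<Gamma> x u v w)"
  unfolding d\<Gamma>_def by (rule linear_fderiv[OF differentiable_\<Gamma>])

lemma smooth_d\<Gamma>: "smooth_on W (\<lambda>x. d\<Gamma> x u v w)"
  unfolding d\<Gamma>_def by (rule smooth_on_fderiv[OF smooth_\<Gamma>])

lemmas \<Gamma>_linear_simps =
  bilinear_ladd[OF bilinear_\<Gamma>] bilinear_radd[OF bilinear_\<Gamma>]
  bilinear_lsub[OF bilinear_\<Gamma>] bilinear_rsub[OF bilinear_\<Gamma>]
  bilinear_lmul[OF bilinear_\<Gamma>] bilinear_rmul[OF bilinear_\<Gamma>]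

lemma smooth_riem: "smooth_on W (\<lambda>x. riem x u v w)"
proof -
  have "smooth_on W (\<lambda>x. \<Gamma> x u (\<Gamma> x v w))" for u v
    using smooth_on_bilinear_family[where B = \<Gamma> and a = "\<lambda>x. u", OF open_W bilinear_\<Gamma> smooth_\<Gamma> smooth_on_const smooth_\<Gamma>] .
  then show ?thesis
    unfolding riem_def by (intro smooth_on_add smooth_on_diff smooth_d\<Gamma> open_W)
qed

lemma linear_riem:
  assumes "x \<in> W"
  shows "linear (\<lambda>u. riem x u v w)" "linear (\<lambda>v. riem x u v w)" "linear (\<lambda>w. riem x u v w)"
proof -
  have L: "linear (\<lambda>v. \<Gamma> x v w)" "linear (\<lambda>w. \<Gamma> x v w)"
    "linear (\<lambda>v. d\<Gamma> x u v w)" "linear (\<lambda>w. d\<Gamma> x u v w)" for u v w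
    using bilinear_\<Gamma>[OF assms] bilinear_d\<Gamma>[OF assms] by (simp_all add: bilinear_def)
  note L' = linear_compose[OF L(1) L(2), unfolded o_def] linear_compose[OF L(2) L(2), unfolded o_def]
  show "linear (\<lambda>u. riem x u v w)" "linear (\<lambda>v. riem x u v w)" "linear (\<lambda>w. riem x u v w)"
    unfolding riem_def
    by (intro linear_compose_add linear_compose_sub linear_d\<Gamma>[OF assms] L L')+
qed

text \<open>Admits non-constant \<open>X\<close> and \<open>Y\<close>, because coordinate fields of
  one chart are not constant in another. After the product rules, the derivatives of
  \<open>X\<close> and \<open>Y\<close> cancel by the vanishing bracket \<open>XY\<close>, the
  second derivatives of \<open>Z\<close> by their symmetry, and the first derivatives of
  \<open>Z\<close> occur symmetrically in \<open>X\<close> and \<open>Y\<close>.\<close>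

lemma covariant_commutator:
  assumes U: "open U" "x \<in> U" "U \<subseteq> W" and X: "X differentiable (at x)" and Y: "Y differentiable (at x)"
    and Z: "smooth_on U Z" and XY: "fderiv Y x (X x) = fderiv X x (Y x)"
  shows "fderiv (\<lambda>y. fderiv Z y (Y y) + \<Gamma> y (Y y) (Z y)) x (X x)
      + \<Gamma> x (X x) (fderiv Z x (Y x) + \<Gamma> x (Y x) (Z x))
    - (fderiv (\<lambda>y. fderiv Z y (X y) + \<Gamma> y (X y) (Z y)) x (Y x)
      + \<Gamma> x (Y x) (fderiv Z x (X x) + \<Gamma> x (X x) (Z x)))
    = riem x (X x) (Y x) (Z x)"
proof -
  have xW: "x \<in> W" using U by auto
  have Z': "(\<lambda>y. fderiv Z y v) differentiable (at x)" "Z differentiable (at y)" if "y \<in> U" for v y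
    using smooth_on_differentiable[OF smooth_on_fderiv[OF Z] U(2)] smooth_on_differentiable[OF Z that] by auto
  have "((\<lambda>y. fderiv Z y (Y y) + \<Gamma> y (Y y) (Z y)) has_derivative
      (\<lambda>u. (fderiv (\<lambda>y. fderiv Z y (Y x)) x u + fderiv Z x (fderiv Y x u))
        + (fderiv (\<lambda>y. \<Gamma> y (Y x) (Z x)) x u + \<Gamma> x (fderiv Y x u) (Z x) + \<Gamma> x (Y x) (fderiv Z x u)))) (at x)"
    if "Y differentiable (at x)" for Y
    using U(2)
    by (intro has_derivative_add has_derivative_bilinear_family[OF open_W xW bilinear_\<Gamma> differentiable_\<Gamma>[OF xW]]
        has_derivative_linear_family[OF U(1,2) linear_fderiv] Z' has_fderiv that)
  note D = fderiv_eqI[OF this, folded d\<Gamma>_def]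
  have "fderiv (\<lambda>y. fderiv Z y (Y x)) x (X x) = fderiv (\<lambda>y. fderiv Z y (X x)) x (Y x)"
    by (rule fderiv_fderiv_commute[OF U(1,2) Z])
  then show ?thesis
    unfolding D[OF X] D[OF Y] XY riem_def by (simp add: \<Gamma>_linear_simps[OF xW])
qed

lemma riem_antisym: "riem x u v w = - riem x v u w"
  by (simp add: riem_def)

lemma fderiv_riem:
  assumes x: "x \<in> W"
  shows "fderiv (\<lambda>y. riem y u v w) x a =
    fderiv (\<lambda>y. d\<Gamma> y u v w) x a - fderiv (\<lambda>y. d\<Gamma> y v u w) x a
    + d\<Gamma> x a u (\<Gamma> x v w) + \<Gamma> x u (d\<Gamma> x a v w) - d\<Gamma> x a v (\<Gamma> x u w) - \<Gamma> x v (d\<Gamma> x a u w)"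
proof -
  have D: "((\<lambda>y. \<Gamma> y p (\<Gamma> y q r)) has_derivative
      (\<lambda>a. d\<Gamma> x a p (\<Gamma> x q r) + \<Gamma> x p (d\<Gamma> x a q r))) (at x)" for p q r
  proof -
    have "((\<lambda>y. \<Gamma> y p (\<Gamma> y q r)) has_derivative
      (\<lambda>a. fderiv (\<lambda>y. \<Gamma> y p (\<Gamma> x q r)) x a + \<Gamma> x 0 (\<Gamma> x q r) + \<Gamma> x p (d\<Gamma> x a q r))) (at x)"
      unfolding d\<Gamma>_def using has_fderiv[OF differentiable_\<Gamma>[OF x]]
      by (intro has_derivative_bilinear_family[OF open_W x bilinear_\<Gamma> differentiable_\<Gamma>[OF x]])
        (auto intro: has_derivative_const)
    then show ?thesis by (simp add: d\<Gamma>_def bilinear_lzero[OF bilinear_\<Gamma>[OF x]])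
  qed
  have D': "((\<lambda>y. d\<Gamma> y p q r) has_derivative fderiv (\<lambda>y. d\<Gamma> y p q r) x) (at x)" for p q r
    by (rule smooth_on_has_derivative[OF smooth_d\<Gamma> x])
  have "((\<lambda>y. riem y u v w) has_derivative
    (\<lambda>a. fderiv (\<lambda>y. d\<Gamma> y u v w) x a - fderiv (\<lambda>y. d\<Gamma> y v u w) x a
    + (d\<Gamma> x a u (\<Gamma> x v w) + \<Gamma> x u (d\<Gamma> x a v w)) - (d\<Gamma> x a v (\<Gamma> x u w) + \<Gamma> x v (d\<Gamma> x a u w)))) (at x)"
    unfolding riem_def by (intro has_derivative_add has_derivative_diff D D')
  from fderiv_eqI[OF this] show ?thesis by simp
qed

text \<open>In essence the Jacobi identity for three covariant derivatives along constant fields,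
  with curvature as the commutator of two of them.\<close>

lemma second_bianchi:
  assumes x: "x \<in> W"
  shows "cov_riem x a u v w + cov_riem x u v a w + cov_riem x v a u w = 0"
proof -
  have comm: "fderiv (\<lambda>y. d\<Gamma> y p q w) x r = fderiv (\<lambda>y. d\<Gamma> y r q w) x p" for p q r
    unfolding d\<Gamma>_def by (rule fderiv_fderiv_commute[OF open_W x smooth_\<Gamma>])
  \<comment> \<open>\<open>K a u v\<close> is the commutator of the covariant derivative along
    \<open>a\<close> with the endomorphism \<open>riem x u v\<close>, applied to \<open>w\<close>.
    It is \<open>cov_riem\<close> without the corrections in the slots \<open>u\<close> and
    \<open>v\<close>; in the cyclic sum those corrections cancel in pairs by the symmetry of
    \<open>\<Gamma>\<close>.\<close>
  define K where "K a u v = fderiv (\<lambda>y. riem y u v w) x a + \<Gamma> x a (riem x u v w) - riem x u v (\<Gamma> x a w)"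
    for a u v
  have 1: "K a u v + K u v a + K v a u = 0"
    unfolding K_def fderiv_riem[OF x]
    by (simp add: riem_def \<Gamma>_linear_simps[OF x] comm[where p = u and r = a]
        comm[where p = v and r = a] comm[where p = u and r = v] algebra_simps)
  have 2: "riem x (\<Gamma> x p q) r w + riem x r (\<Gamma> x q p) w = 0" for p q r
    using riem_antisym[of x "\<Gamma> x p q" r w] commute_\<Gamma>[OF x, of p q] by simp
  have "cov_riem x a u v w + cov_riem x u v a w + cov_riem x v a u w =
    (K a u v + K u v a + K v a u)
    - (riem x (\<Gamma> x a u) v w + riem x v (\<Gamma> x u a) w)
    - (riem x (\<Gamma> x u v) a w + riem x a (\<Gamma> x v u) w)
    - (riem x (\<Gamma> x v a) u w + riem x u (\<Gamma> x a v) w)"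
    unfolding cov_riem_def K_def by (simp add: algebra_simps)
  then show ?thesis unfolding 1 2 by simp
qed

lemma cov_riem_antisym:
  assumes "x \<in> W"
  shows "cov_riem x a u v w = - cov_riem x a v u w"
proof -
  have "((\<lambda>y. - riem y v u w) has_derivative (\<lambda>a. - fderiv (\<lambda>y. riem y v u w) x a)) (at x)"
    by (intro has_derivative_minus smooth_on_has_derivative[OF smooth_riem assms])
  then have "fderiv (\<lambda>y. riem y u v w) x a = - fderiv (\<lambda>y. riem y v u w) x a"
    unfolding riem_antisym[of _ u v] by (simp add: fderiv_eqI)
  then show ?thesis
    unfolding cov_riem_def riem_antisym[of x u v] riem_antisym[of x "\<Gamma> x a u" v]
      riem_antisym[of x u "\<Gamma> x a v"]
    using bilinear_rneg[OF bilinear_\<Gamma>[OF assms]] by simp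
qed

lemma linear_cov_riem:
  assumes x: "x \<in> W"
  shows "linear (\<lambda>u. cov_riem x a u v w)"
proof -
  have "linear (\<lambda>u. fderiv (\<lambda>y. riem y u v w) x a)"
    by (intro linear_fderiv_family[OF open_W x linear_riem(1)] smooth_on_differentiable[OF smooth_riem] x)
  moreover have "linear (\<Gamma> x a)" using bilinear_\<Gamma>[OF x] by (simp add: bilinear_def)
  moreover note linear_riem[OF x]
  ultimately show ?thesis
    unfolding cov_riem_def linear_iff by (simp add: algebra_simps)
qed

lemma bilinear_ric:
  assumes "x \<in> W"
  shows "bilinear (ric x)"
  unfolding bilinear_def ric_def tr_eq linear_iff
  by (simp add: linear_add[OF linear_riem(2)[OF assms]] linear_add[OF linear_riem(3)[OF assms]]
      linear_scale[OF linear_riem(2)[OF assms]] linear_scale[OF linear_riem(3)[OF assms]]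
      sum.distrib sum_distrib_left)

lemma smooth_ric: "smooth_on W (\<lambda>x. ric x v w)"
  unfolding ric_def tr_eq
  by (intro smooth_on_sum smooth_on_bounded_linear[OF bounded_linear_vec_nth] smooth_riem open_W)

text \<open>Covariant differentiation commutes with the trace: the correction acting on the value
  and the one acting on the traced slot are compositions of the same two maps in opposite
  orders.\<close>

lemma tr_cov_riem:
  assumes x: "x \<in> W"
  shows "tr (\<lambda>u. cov_riem x a u v w) = cov_ric x a v w"
proof -
  have "((\<lambda>y. ric y v w) has_derivative (\<lambda>a. \<Sum>i\<in>UNIV. fderiv (\<lambda>y. riem y (axis i 1) v w) x a $ i)) (at x)"
    unfolding ric_def tr_eq
    by (intro has_derivative_sum bounded_linear.has_derivative[OF bounded_linear_vec_nth]
        smooth_on_has_derivative[OF smooth_riem x])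
  then have "fderiv (\<lambda>y. ric y v w) x a = tr (\<lambda>u. fderiv (\<lambda>y. riem y u v w) x a)"
    by (simp add: fderiv_eqI tr_eq)
  moreover have "tr (\<lambda>u. \<Gamma> x a (riem x u v w)) = tr (\<lambda>u. riem x (\<Gamma> x a u) v w)"
    using bilinear_\<Gamma>[OF x] by (intro tr_compose_commute linear_riem[OF x]) (simp add: bilinear_def)
  ultimately show ?thesis
    unfolding cov_riem_def cov_ric_def tr_add tr_diff by (simp add: ric_def)
qed

end

section \<open>Metric connections: skewness of the curvature and the contracted Bianchi
  identity\<close>

locale metric_connection = smooth_connection W \<Gamma>
  for W :: "(real ^ 'n::finite) set" and \<Gamma> +
  fixes G :: "real ^ 'n \<Rightarrow> real ^ 'n \<Rightarrow> real ^ 'n \<Rightarrow> real"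
  assumes bilinear_G: "x \<in> W \<Longrightarrow> bilinear (G x)"
    and commute_G: "x \<in> W \<Longrightarrow> G x v w = G x w v"
    and smooth_G: "smooth_on W (\<lambda>x. G x v w)"
    and positive_G: "x \<in> W \<Longrightarrow> v \<noteq> 0 \<Longrightarrow> G x v v > 0"
    and compatible: "x \<in> W \<Longrightarrow> fderiv (\<lambda>y. G y v w) x u = G x (\<Gamma> x u v) w + G x v (\<Gamma> x u w)"
begin

lemmas G_linear_simps =
  bilinear_ladd[OF bilinear_G] bilinear_radd[OF bilinear_G]
  bilinear_lsub[OF bilinear_G] bilinear_rsub[OF bilinear_G]
  bilinear_lmul[OF bilinear_G] bilinear_rmul[OF bilinear_G]
  bilinear_lneg[OF bilinear_G] bilinear_rneg[OF bilinear_G]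
  bilinear_lzero[OF bilinear_G] bilinear_rzero[OF bilinear_G]

lemma differentiable_G: "x \<in> W \<Longrightarrow> (\<lambda>y. G y v w) differentiable (at x)"
  by (rule smooth_on_differentiable[OF smooth_G])

text \<open>\<open>compatible\<close> merges with the product rule, so that each argument is
  differentiated covariantly.\<close>

lemma has_derivative_G:
  assumes x: "x \<in> W" and a: "(a has_derivative a') (at x)" and b: "(b has_derivative b') (at x)"
  shows "((\<lambda>y. G y (a y) (b y)) has_derivative
    (\<lambda>u. G x (a' u + \<Gamma> x u (a x)) (b x) + G x (a x) (b' u + \<Gamma> x u (b x)))) (at x)"
  using has_derivative_bilinear_family[OF open_W x bilinear_G differentiable_G[OF x] a b]
  by (simp add: compatible[OF x] G_linear_simps[OF x] add_ac)

text \<open>Second derivatives of \<open>G y z w\<close> commute. Expanded by compatibility, the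
  products of two Christoffel terms in different slots are symmetric in \<open>u\<close> and
  \<open>v\<close>; what remains of the difference of the two orders is the curvature in each
  slot.\<close>

lemma riem_skew:
  assumes x: "x \<in> W"
  shows "G x (riem x u v z) w + G x z (riem x u v w) = 0"
proof -
  have 1: "fderiv (\<lambda>y. fderiv (\<lambda>y. G y z w) y v) x u =
     G x (d\<Gamma> x u v z + \<Gamma> x u (\<Gamma> x v z)) w + G x (\<Gamma> x v z) (\<Gamma> x u w)
     + (G x (\<Gamma> x u z) (\<Gamma> x v w) + G x z (d\<Gamma> x u v w + \<Gamma> x u (\<Gamma> x v w)))" for u v
  proof -
    have d: "((\<lambda>y. \<Gamma> y v p) has_derivative (\<lambda>u. d\<Gamma> x u v p)) (at x)" for p
      unfolding d\<Gamma>_def by (rule has_fderiv[OF differentiable_\<Gamma>[OF x]])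
    have "((\<lambda>y. G y (\<Gamma> y v z) w + G y z (\<Gamma> y v w)) has_derivative
        (\<lambda>u. (G x (d\<Gamma> x u v z + \<Gamma> x u (\<Gamma> x v z)) w + G x (\<Gamma> x v z) (0 + \<Gamma> x u w))
         + (G x (0 + \<Gamma> x u z) (\<Gamma> x v w) + G x z (d\<Gamma> x u v w + \<Gamma> x u (\<Gamma> x v w))))) (at x)"
      by (intro has_derivative_add has_derivative_G[OF x] d has_derivative_const)
    then have "((\<lambda>y. fderiv (\<lambda>y. G y z w) y v) has_derivative
        (\<lambda>u. (G x (d\<Gamma> x u v z + \<Gamma> x u (\<Gamma> x v z)) w + G x (\<Gamma> x v z) (0 + \<Gamma> x u w))
         + (G x (0 + \<Gamma> x u z) (\<Gamma> x v w) + G x z (d\<Gamma> x u v w + \<Gamma> x u (\<Gamma> x v w))))) (at x)"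
      by (rule has_derivative_transform_within_open[OF _ open_W x]) (simp add: compatible)
    then show ?thesis by (simp add: fderiv_eqI)
  qed
  from fderiv_fderiv_commute[OF open_W x smooth_G[of z w], of v u]
  show ?thesis
    unfolding 1 by (simp add: riem_def G_linear_simps[OF x])
qed

text \<open>The identity \<open>riem_skew\<close> holds throughout \<open>W\<close>, so its
  left-hand side has derivative zero. The four further instances of \<open>riem_skew\<close> absorb
  the corrections in \<open>u\<close>, \<open>v\<close>, \<open>z\<close> and
  \<open>w\<close>.\<close>

lemma cov_riem_skew:
  assumes x: "x \<in> W"
  shows "G x (cov_riem x a u v z) w + G x z (cov_riem x a u v w) = 0"
proof -
  have d: "((\<lambda>y. riem y u v p) has_derivative fderiv (\<lambda>y. riem y u v p) x) (at x)" for p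
    by (rule smooth_on_has_derivative[OF smooth_riem x])
  have 1: "((\<lambda>y. G y (riem y u v z) w + G y z (riem y u v w)) has_derivative
      (\<lambda>a. (G x (fderiv (\<lambda>y. riem y u v z) x a + \<Gamma> x a (riem x u v z)) w
          + G x (riem x u v z) (0 + \<Gamma> x a w))
       + (G x (0 + \<Gamma> x a z) (riem x u v w)
          + G x z (fderiv (\<lambda>y. riem y u v w) x a + \<Gamma> x a (riem x u v w))))) (at x)"
    by (intro has_derivative_add has_derivative_G[OF x] d has_derivative_const)
  have 2: "((\<lambda>y. G y (riem y u v z) w + G y z (riem y u v w)) has_derivative (\<lambda>a. 0)) (at x)"
    by (rule has_derivative_transform_within_open[OF has_derivative_const open_W x]) (simp add: riem_skew)
  show ?thesis
    using fun_cong[OF has_derivative_unique[OF 1 2], of a]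
      riem_skew[OF x, of "\<Gamma> x a u" v z w] riem_skew[OF x, of u "\<Gamma> x a v" z w]
      riem_skew[OF x, of u v "\<Gamma> x a z" w] riem_skew[OF x, of u v z "\<Gamma> x a w"]
    unfolding cov_riem_def by (simp add: G_linear_simps[OF x])
qed

text \<open>The Bianchi sum for \<open>w\<close>, \<open>E i\<close>, \<open>E j\<close> is applied
  to \<open>E j\<close> and paired with \<open>E i\<close>. Skewness for \<open>G\<close> brings the
  second term, antisymmetry in the first two curvature slots the third, to minus the same trace.
  There \<open>w\<close> sits in the first slot of the differentiated Ricci tensor.\<close>

lemma contracted_bianchi:
  assumes x: "x \<in> W" and "orthonormal_basis (G x) E"
  shows "(\<Sum>i\<in>UNIV. cov_ric x w (E i) (E i)) = 2 * (\<Sum>i\<in>UNIV. cov_ric x (E i) w (E i))"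
proof -
  interpret orthonormal_basis "G x" E by fact
  have ric: "cov_ric x a v z = (\<Sum>i\<in>UNIV. G x (cov_riem x a (E i) v z) (E i))" for a v z
    using tr_conv[OF linear_cov_riem[OF x]] by (simp add: tr_cov_riem[OF x])
  have skew: "G x (cov_riem x (E i) (E j) w (E j)) (E i) = - G x (cov_riem x (E i) (E j) w (E i)) (E j)" for i j
    using cov_riem_skew[OF x, of "E i" "E j" w "E j" "E i"] commute_G[OF x, of "E j"] by simp
  have anti: "cov_riem x (E j) w (E i) (E j) = - cov_riem x (E j) (E i) w (E j)" for i j
    by (rule cov_riem_antisym[OF x])
  have "0 = (\<Sum>j\<in>UNIV. \<Sum>i\<in>UNIV. G x (cov_riem x w (E i) (E j) (E j)
     + cov_riem x (E i) (E j) w (E j) + cov_riem x (E j) w (E i) (E j)) (E i))"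
    by (simp add: second_bianchi[OF x] G_linear_simps[OF x])
  also have "\<dots> = (\<Sum>j\<in>UNIV. cov_ric x w (E j) (E j))
      - (\<Sum>j\<in>UNIV. \<Sum>i\<in>UNIV. G x (cov_riem x (E i) (E j) w (E i)) (E j))
      - (\<Sum>j\<in>UNIV. cov_ric x (E j) w (E j))"
    unfolding anti ric G_linear_simps(1,3,7)[OF x] skew
    by (simp add: sum.distrib sum_subtractf)
  also have "(\<Sum>j\<in>UNIV. \<Sum>i\<in>UNIV. G x (cov_riem x (E i) (E j) w (E i)) (E j)) = (\<Sum>i\<in>UNIV. cov_ric x (E i) w (E i))"
    unfolding ric by (rule sum.swap)
  finally show ?thesis by simp
qed

text \<open>Gram-Schmidt with smooth dependence on the point, one index at a time; the neighbourhood
  shrinks at each stage so that the next vector stays nonzero.\<close>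

lemma orthonormal_frame_exists:
  assumes x0: "x0 \<in> W"
  shows "\<exists>U (E :: 'n \<Rightarrow> real ^ 'n \<Rightarrow> real ^ 'n). open U \<and> x0 \<in> U \<and> U \<subseteq> W \<and>
    (\<forall>i. smooth_on U (E i)) \<and>
    (\<forall>x\<in>U. \<forall>i j. G x (E i x) (E j x) = (if i = j then 1 else 0))"
proof -
  have "\<exists>U (E :: 'n \<Rightarrow> real ^ 'n \<Rightarrow> real ^ 'n). open U \<and> x0 \<in> U \<and> U \<subseteq> W \<and> (\<forall>i\<in>I. smooth_on U (E i)) \<and>
      (\<forall>x\<in>U. \<forall>i\<in>I. \<forall>j\<in>I. G x (E i x) (E j x) = (if i = j then 1 else 0))" for I :: "'n set"
  proof (induction I rule: finite_induct[OF finite])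
    case 1
    then show ?case using open_W x0 by auto
  next
    case (2 k I)
    then obtain U E where U: "open U" "x0 \<in> U" "U \<subseteq> W" and E: "\<And>i. i \<in> I \<Longrightarrow> smooth_on U (E i)"
      and on: "\<And>x i j. x \<in> U \<Longrightarrow> i \<in> I \<Longrightarrow> j \<in> I \<Longrightarrow> G x (E i x) (E j x) = (if i = j then 1 else 0)"
      by blast
    \<comment> \<open>The vectors found so far are fewer than the dimension, so some constant
      \<open>v\<close> lies outside their span at \<open>x0\<close>.\<close>
    have "card ((\<lambda>i. E i x0) ` I) \<le> card I" by (simp add: card_image_le)
    also have "card I < card (insert k I)" using 2 by simp
    also have "card (insert k I) \<le> CARD('n)" by (rule card_mono) auto
    finally have "dim ((\<lambda>i. E i x0) ` I) < DIM(real ^ 'n)"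
      using dim_le_card'[of "(\<lambda>i. E i x0) ` I"] by simp
    then have "span ((\<lambda>i. E i x0) ` I) \<noteq> UNIV"
      by (metis dim_UNIV dim_span less_irrefl)
    then obtain v where v: "v \<notin> span ((\<lambda>i. E i x0) ` I)" by blast
    \<comment> \<open>\<open>v\<close> minus its projection onto the earlier frame vectors. Its
      squared length \<open>h\<close> is positive at \<open>x0\<close> by the choice of
      \<open>v\<close>, hence near \<open>x0\<close> by continuity.\<close>
    define N where "N x = v - (\<Sum>i\<in>I. G x v (E i x) *\<^sub>R E i x)" for x
    define h where "h x = G x (N x) (N x)" for x
    have GU: "bilinear (G x)" "linear (G x w)" "linear (\<lambda>v. G x v w)" if "x \<in> U" for x w
      using bilinear_G that U(3) by (auto simp: bilinear_def)
    have smG: "smooth_on U (\<lambda>x. G x a b)" for a b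
      by (rule smooth_on_subset[OF smooth_G U(3)])
    have "smooth_on U (\<lambda>x. G x v (E i x))" if "i \<in> I" for i
      by (rule smooth_on_linear_family[OF U(1) GU(2) smG E[OF that]])
    then have smN: "smooth_on U N"
      unfolding N_def by (intro smooth_on_diff smooth_on_sum smooth_on_scaleR U(1) smooth_on_const E)
    then have smh: "smooth_on U h"
      unfolding h_def by (intro smooth_on_bilinear_family[OF U(1) GU(1) smG])
    have NE: "G x (N x) (E j x) = 0" if "x \<in> U" "j \<in> I" for x j
    proof -
      have "G x (N x) (E j x) = G x v (E j x) - (\<Sum>i\<in>I. G x v (E i x) * G x (E i x) (E j x))"
        unfolding N_def using GU(3)[OF that(1)]
        by (simp add: linear_diff[of "\<lambda>v. G x v (E j x)"] linear_sum[of "\<lambda>v. G x v (E j x)"]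
            linear_scale[of "\<lambda>v. G x v (E j x)"])
      also have "(\<Sum>i\<in>I. G x v (E i x) * G x (E i x) (E j x)) = (\<Sum>i\<in>I. if i = j then G x v (E i x) else 0)"
        using that by (intro sum.cong) (auto simp: on)
      finally show ?thesis using that 2 by simp
    qed
    have "(\<Sum>i\<in>I. G x0 v (E i x0) *\<^sub>R E i x0) \<in> span ((\<lambda>i. E i x0) ` I)"
      by (intro span_sum span_scale span_base) auto
    then have "N x0 \<noteq> 0" using v by (auto simp: N_def)
    then have h0: "h x0 > 0" using positive_G[OF x0] by (simp add: h_def)
    define U' where "U' = {x \<in> U. h x \<in> {0<..}}"
    have U': "open U'" "x0 \<in> U'" "U' \<subseteq> U" "\<And>x. x \<in> U' \<Longrightarrow> h x > 0"
      using continuous_open_preimage[OF smooth_on_continuous_on[OF smh] U(1), of "{0<..}"] U h0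
      by (auto simp: U'_def vimage_def Int_def)
    define F where "F = E(k := \<lambda>x. h x powr (-1/2) *\<^sub>R N x)"
    have "smooth_on U' (\<lambda>x. h x powr (-1/2))"
      using U' by (intro smooth_on_compose[OF smooth_on_powr] smooth_on_subset[OF smh]) auto
    then have "smooth_on U' (\<lambda>x. h x powr (-1/2) *\<^sub>R N x)"
      by (intro smooth_on_scaleR U'(1) smooth_on_subset[OF smN U'(3)])
    then have smF: "smooth_on U' (F i)" if "i \<in> insert k I" for i
      using that smooth_on_subset[OF E U'(3)] by (auto simp: F_def)
    have "G x (F i x) (F j x) = (if i = j then 1 else 0)"
      if "x \<in> U'" "i \<in> insert k I" "j \<in> insert k I" for x i j
    proof -
      have xU: "x \<in> U" "x \<in> W" and hx: "h x > 0" using that U' U by auto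
      note lin = linear_scale[OF GU(2)[OF xU(1)]] linear_scale[OF GU(3)[OF xU(1)]]
      have kk: "G x (F k x) (F k x) = 1"
      proof -
        have "G x (F k x) (F k x) = h x powr (-1/2) * (h x powr (-1/2) * h x)"
          by (simp add: F_def lin h_def)
        \<comment> \<open>With \<open>h x\<close> written as a power, the exponents -1/2, -1/2 and 1
          add up to 0.\<close>
        also have "\<dots> = h x powr (-1/2) * (h x powr (-1/2) * h x powr 1)" using hx by simp
        also have "\<dots> = 1" using hx unfolding powr_add[symmetric] by simp
        finally show ?thesis .
      qed
      have kj: "G x (F k x) (F j x) = 0" if "j \<in> I" for j
        using NE[OF xU(1) that] 2(2) that by (auto simp: F_def lin)
      have "G x (F j x) (F k x) = 0" if "j \<in> I" for j
        using kj[OF that] commute_G[OF xU(2)] by simp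
      moreover have "F j = E j" if "j \<in> I" for j
        using that 2(2) by (auto simp: F_def)
      ultimately show ?thesis
        using that(2,3) kk kj on[OF xU(1)] 2(2) by auto
    qed
    then show ?case using U' U smF by (intro exI[of _ U'] exI[of _ F]) auto
  qed
  from this[of UNIV] show ?thesis by (simp only: ball_UNIV)
qed

text \<open>The frame moves with the point, but its Gram matrix is constant, so the covariant
  derivatives \<open>a v i\<close> of its members form a skew matrix and contribute nothing by
  \<open>contract_skew\<close>. Only the covariant derivative of the Ricci tensor survives.\<close>

lemma has_derivative_scal:
  assumes x: "x \<in> U" and U: "open U" "U \<subseteq> W" and E: "\<And>y. y \<in> U \<Longrightarrow> orthonormal_basis (G y) (\<lambda>i. E i y)"
    and diff: "\<And>i. E i differentiable (at x)"
  shows "((\<lambda>y. \<Sum>i\<in>UNIV. ric y (E i y) (E i y)) has_derivative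
    (\<lambda>v. \<Sum>i\<in>UNIV. cov_ric x v (E i x) (E i x))) (at x)"
proof -
  have xW: "x \<in> W" using x U by auto
  interpret orthonormal_basis "G x" "\<lambda>i. E i x" using E x .
  define a where "a v i = fderiv (E i) x v + \<Gamma> x v (E i x)" for v i
  note D = has_fderiv[OF diff]
  have 1: "((\<lambda>y. G y (E i y) (E j y)) has_derivative
      (\<lambda>v. G x (a v i) (E j x) + G x (E i x) (a v j))) (at x)" for i j
    unfolding a_def by (rule has_derivative_G[OF xW D D])
  have 2: "((\<lambda>y. G y (E i y) (E j y)) has_derivative (\<lambda>v. 0)) (at x)" for i j
    using orthonormal_basis.orthonormal[OF E]
    by (intro has_derivative_transform_within_open[OF has_derivative_const[of "if i = j then 1 else 0"] U(1) x]) simp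
  have skew: "G x (a v i) (E j x) + G x (E i x) (a v j) = 0" for v i j
    using fun_cong[OF has_derivative_unique[OF 1 2], of v] .
  have r: "((\<lambda>y. ric y (E i y) (E i y)) has_derivative
      (\<lambda>v. fderiv (\<lambda>y. ric y (E i x) (E i x)) x v + ric x (fderiv (E i) x v) (E i x)
         + ric x (E i x) (fderiv (E i) x v))) (at x)" for i
    by (intro has_derivative_bilinear_family[OF open_W xW] bilinear_ric smooth_on_differentiable[OF smooth_ric] D xW)
  have "fderiv (\<lambda>y. ric y (E i x) (E i x)) x v + ric x (fderiv (E i) x v) (E i x)
         + ric x (E i x) (fderiv (E i) x v) =
      cov_ric x v (E i x) (E i x) + (ric x (a v i) (E i x) + ric x (E i x) (a v i))" for i v
    unfolding cov_ric_def a_def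
    by (simp add: bilinear_ladd[OF bilinear_ric[OF xW]] bilinear_radd[OF bilinear_ric[OF xW]])
  then have "(\<Sum>i\<in>UNIV. fderiv (\<lambda>y. ric y (E i x) (E i x)) x v + ric x (fderiv (E i) x v) (E i x)
         + ric x (E i x) (fderiv (E i) x v)) = (\<Sum>i\<in>UNIV. cov_ric x v (E i x) (E i x))" for v
    using contract_skew[OF bilinear_ric[OF xW] skew] by (simp add: sum.distrib)
  moreover have "((\<lambda>y. \<Sum>i\<in>UNIV. ric y (E i y) (E i y)) has_derivative
      (\<lambda>v. \<Sum>i\<in>UNIV. fderiv (\<lambda>y. ric y (E i x) (E i x)) x v + ric x (fderiv (E i) x v) (E i x)
         + ric x (E i x) (fderiv (E i) x v))) (at x)"
    by (rule has_derivative_sum[OF r])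
  ultimately show ?thesis by simp
qed

end

section \<open>Charts\<close>

locale atlas =
  fixes A :: "('m::{t2_space, second_countable_topology}, 'n::finite) chart set"
  assumes atlas: "smooth_atlas A"
begin

lemma chart_homeomorphism:
  "c \<in> A \<Longrightarrow> homeomorphism (fst c) (snd c ` fst c) (snd c) (chart_inv c)"
  using atlas by (auto simp: smooth_atlas_def)

lemma chart_inv_left [simp]: "c \<in> A \<Longrightarrow> p \<in> fst c \<Longrightarrow> chart_inv c (snd c p) = p"
  using chart_homeomorphism by (auto simp: homeomorphism_def)

lemma open_fst: "c \<in> A \<Longrightarrow> open (fst c)"
  using atlas by (auto simp: smooth_atlas_def)

lemma open_chart_image:
  assumes "c \<in> A" "open U"
  shows "open (snd c ` (fst c \<inter> U))"
proof -
  have "open (chart_inv c -` U \<inter> snd c ` fst c)"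
    using continuous_open_preimage[of "snd c ` fst c" "chart_inv c" U] assms atlas
    by (auto simp: smooth_atlas_def homeomorphism_def Int_commute)
  also have "chart_inv c -` U \<inter> snd c ` fst c = snd c ` (fst c \<inter> U)"
    using assms(1) by auto
  finally show ?thesis .
qed

lemma open_chart_image_subset: "c \<in> A \<Longrightarrow> open U \<Longrightarrow> U \<subseteq> fst c \<Longrightarrow> open (snd c ` U)"
  using open_chart_image[of c U] by (simp add: inf_absorb2)

lemma open_chart_range: "c \<in> A \<Longrightarrow> open (snd c ` fst c)"
  by (simp add: open_chart_image_subset open_fst)

lemma chart_at: "chart_at A p \<in> A" "p \<in> fst (chart_at A p)"
proof -
  have "p \<in> (\<Union>c\<in>A. fst c)" using atlas by (simp add: smooth_atlas_def)
  then have "\<exists>c. c \<in> A \<and> p \<in> fst c" by blast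
  from someI_ex[OF this] show "chart_at A p \<in> A" "p \<in> fst (chart_at A p)"
    by (auto simp: chart_at_def)
qed

lemma smooth_transition:
  "c \<in> A \<Longrightarrow> c' \<in> A \<Longrightarrow> smooth_on (snd c ` (fst c \<inter> fst c')) (snd c' \<circ> chart_inv c)"
  using atlas by (auto simp: smooth_atlas_def)

lemma has_derivative_transition:
  assumes "c \<in> A" "c' \<in> A" "p \<in> fst c" "p \<in> fst c'"
  shows "((snd c' \<circ> chart_inv c) has_derivative coord_change c c' p) (at (snd c p))"
  unfolding coord_change_def
  using assms by (intro smooth_on_has_derivative[OF smooth_transition]) auto

lemma linear_coord_change:
  "c \<in> A \<Longrightarrow> c' \<in> A \<Longrightarrow> p \<in> fst c \<Longrightarrow> p \<in> fst c' \<Longrightarrow> linear (coord_change c c' p)"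
  using has_derivative_transition has_derivative_linear by blast

lemma coord_change_self [simp]:
  assumes "c \<in> A" "p \<in> fst c"
  shows "coord_change c c p = (\<lambda>v. v)"
proof -
  have "((snd c \<circ> chart_inv c) has_derivative (\<lambda>v. v)) (at (snd c p))"
    by (rule has_derivative_transform_within_open[OF has_derivative_ident open_chart_range])
      (use assms in auto)
  then show ?thesis unfolding coord_change_def by (rule fderiv_eqI)
qed

lemma coord_change_trans:
  assumes "c \<in> A" "c' \<in> A" "c'' \<in> A" "p \<in> fst c" "p \<in> fst c'" "p \<in> fst c''"
  shows "coord_change c' c'' p (coord_change c c' p v) = coord_change c c'' p v"
proof -
  have "((snd c'' \<circ> chart_inv c') has_derivative coord_change c' c'' p) (at ((snd c' \<circ> chart_inv c) (snd c p)))"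
    using has_derivative_transition[of c' c'' p] assms by simp
  from diff_chain_at[OF has_derivative_transition[OF assms(1,2,4,5)] this]
  have "((snd c'' \<circ> chart_inv c' \<circ> (snd c' \<circ> chart_inv c)) has_derivative
      coord_change c' c'' p \<circ> coord_change c c' p) (at (snd c p))" .
  then have "((snd c'' \<circ> chart_inv c) has_derivative
      coord_change c' c'' p \<circ> coord_change c c' p) (at (snd c p))"
    by (rule has_derivative_transform_within_open[OF _ open_chart_image[of c "fst c'"]])
      (use assms open_fst in auto)
  then have "coord_change c c'' p = coord_change c' c'' p \<circ> coord_change c c' p"
    unfolding coord_change_def[of c c''] by (rule fderiv_eqI)
  then show ?thesis by simp
qed

text \<open>From components in the preferred chart of \<open>q\<close> to components in the fixed
  chart \<open>c\<close>, the inverse of \<open>coord_field A c _ q\<close>. This is the passage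
  that removes the jumps of \<open>chart_at A\<close>.\<close>

abbreviation crd :: "('m, 'n) chart \<Rightarrow> 'm \<Rightarrow> real ^ 'n \<Rightarrow> real ^ 'n" where
  "crd c q \<equiv> coord_change (chart_at A q) c q"

lemma linear_crd: "c \<in> A \<Longrightarrow> q \<in> fst c \<Longrightarrow> linear (crd c q)"
  by (intro linear_coord_change chart_at)

lemma linear_coord_field: "c \<in> A \<Longrightarrow> q \<in> fst c \<Longrightarrow> linear (\<lambda>x. coord_field A c x q)"
  unfolding coord_field_def by (intro linear_coord_change chart_at)

lemma crd_coord_field [simp]: "c \<in> A \<Longrightarrow> q \<in> fst c \<Longrightarrow> crd c q (coord_field A c x q) = x"
  unfolding coord_field_def by (simp add: coord_change_trans chart_at)

lemma coord_field_crd [simp]: "c \<in> A \<Longrightarrow> q \<in> fst c \<Longrightarrow> coord_field A c (crd c q v) q = v"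
  unfolding coord_field_def by (simp add: coord_change_trans chart_at)

lemma crd_inject: "c \<in> A \<Longrightarrow> q \<in> fst c \<Longrightarrow> crd c q v = crd c q w \<longleftrightarrow> v = w"
  by (metis coord_field_crd)

lemma coord_field_chart_at [simp]: "coord_field A (chart_at A q) x q = x"
  unfolding coord_field_def by (simp add: chart_at)

lemma vf_rep_eq: "c \<in> A \<Longrightarrow> q \<in> fst c \<Longrightarrow> vf_rep A c X (snd c q) = crd c q (X q)"
  by (simp add: vf_rep_def)

section \<open>Testing smoothness in a single chart\<close>

lemma smooth_functionI:
  assumes c: "c \<in> A" and U: "open U" "U \<subseteq> fst c" and f: "smooth_on (snd c ` U) (f \<circ> chart_inv c)"
  shows "smooth_function A U f"
  unfolding smooth_function_def
proof
  fix c' assume c': "c' \<in> A"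
  have op: "open (snd c' ` (fst c' \<inter> U))" by (rule open_chart_image[OF c' U(1)])
  have "smooth_on (snd c' ` (fst c' \<inter> U)) (\<lambda>x. (f \<circ> chart_inv c) ((snd c \<circ> chart_inv c') x))"
    using c c' U by (intro smooth_on_compose[OF f smooth_on_subset[OF smooth_transition[OF c' c]] op]) auto
  then show "smooth_on (snd c' ` (fst c' \<inter> U)) (f \<circ> chart_inv c')"
    by (rule smooth_on_cong[OF _ op]) (use c c' U in auto)
qed

lemma smooth_functionD:
  "smooth_function A U f \<Longrightarrow> c \<in> A \<Longrightarrow> smooth_on (snd c ` (fst c \<inter> U)) (f \<circ> chart_inv c)"
  by (simp add: smooth_function_def)

lemma smooth_function_const: "smooth_function A U (\<lambda>q. k)"
  by (simp add: smooth_function_def o_def)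

lemma smooth_vfieldD:
  "smooth_vfield A U X \<Longrightarrow> c \<in> A \<Longrightarrow> smooth_on (snd c ` (fst c \<inter> U)) (vf_rep A c X)"
  by (simp add: smooth_vfield_def)

lemma smooth_vfield_subset: "smooth_vfield A U X \<Longrightarrow> V \<subseteq> U \<Longrightarrow> smooth_vfield A V X"
  unfolding smooth_vfield_def by (meson smooth_on_subset image_mono Int_mono subset_refl)

lemma smooth_vfield_cong:
  assumes "smooth_vfield A U X" "open U" "\<And>q. q \<in> U \<Longrightarrow> X q = Y q"
  shows "smooth_vfield A U Y"
  unfolding smooth_vfield_def
proof
  fix c assume c: "c \<in> A"
  show "smooth_on (snd c ` (fst c \<inter> U)) (vf_rep A c Y)"
    by (rule smooth_on_cong[OF smooth_vfieldD[OF assms(1) c] open_chart_image[OF c assms(2)]])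
      (use c assms(3) in \<open>auto simp: vf_rep_eq\<close>)
qed

text \<open>Components in a further chart arise from those in \<open>c\<close> by applying the
  Jacobian of the transition map and composing with the inverse transition, both of which are
  smooth.\<close>

lemma smooth_vfieldI:
  assumes c: "c \<in> A" and U: "open U" "U \<subseteq> fst c" and X: "smooth_on (snd c ` U) (vf_rep A c X)"
  shows "smooth_vfield A U X"
  unfolding smooth_vfield_def
proof
  fix c' assume c': "c' \<in> A"
  define V where "V = fst c' \<inter> U"
  have V: "open V" "V \<subseteq> fst c'" "V \<subseteq> U" "V \<subseteq> fst c" using U open_fst[OF c'] by (auto simp: V_def)
  have op: "open (snd c' ` V)" "open (snd c ` V)"
    using c c' V by (auto intro!: open_chart_image_subset)
  have \<tau>: "smooth_on (snd c ` V) (snd c' \<circ> chart_inv c)" "smooth_on (snd c' ` V) (snd c \<circ> chart_inv c')"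
    using V by (intro smooth_on_subset[OF smooth_transition[OF c c']]
        smooth_on_subset[OF smooth_transition[OF c' c]], auto)+
  have "smooth_on (snd c ` V) (\<lambda>x. fderiv (snd c' \<circ> chart_inv c) x (vf_rep A c X x))"
    by (rule smooth_on_linear_family[OF op(2) linear_fderiv[OF smooth_on_differentiable[OF \<tau>(1)]]
        smooth_on_fderiv[OF \<tau>(1)] smooth_on_subset[OF X image_mono[OF V(3)]]])
  moreover have "(snd c \<circ> chart_inv c') ` snd c' ` V \<subseteq> snd c ` V"
    using c' V by auto
  ultimately have "smooth_on (snd c' ` V) (\<lambda>x. fderiv (snd c' \<circ> chart_inv c) ((snd c \<circ> chart_inv c') x)
      (vf_rep A c X ((snd c \<circ> chart_inv c') x)))"
    by (rule smooth_on_compose[OF _ \<tau>(2) op(1)])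
  then have "smooth_on (snd c' ` V) (vf_rep A c' X)"
  proof (rule smooth_on_cong[OF _ op(1)])
    fix x assume "x \<in> snd c' ` V"
    then obtain q where q: "q \<in> V" "x = snd c' q" by auto
    with V c c' show "fderiv (snd c' \<circ> chart_inv c) ((snd c \<circ> chart_inv c') x)
      (vf_rep A c X ((snd c \<circ> chart_inv c') x)) = vf_rep A c' X x"
      using coord_change_trans[of "chart_at A q" c c' q "X q"]
      by (auto simp: vf_rep_eq subset_iff coord_change_def[of c c'] chart_at)
  qed
  then show "smooth_on (snd c' ` (fst c' \<inter> U)) (vf_rep A c' X)" by (simp add: V_def)
qed

lemma smooth_vfieldI_rep:
  assumes c: "c \<in> A" and U: "open U" "U \<subseteq> fst c" and Y: "smooth_on (snd c ` U) Y"
    and eq: "\<And>q. q \<in> U \<Longrightarrow> crd c q (X q) = Y (snd c q)"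
  shows "smooth_vfield A U X"
  by (intro smooth_vfieldI[OF c U] smooth_on_cong[OF Y open_chart_image_subset[OF c U]])
    (use c U eq in \<open>auto simp: vf_rep_eq subset_iff\<close>)

lemma smooth_coord_field: "c \<in> A \<Longrightarrow> smooth_vfield A (fst c) (coord_field A c x)"
  by (rule smooth_vfieldI_rep[where Y = "\<lambda>_. x"]) (auto simp: open_fst)

lemma smooth_vfield_sum:
  assumes "open U" "\<And>i. i \<in> I \<Longrightarrow> smooth_vfield A U (Y i)"
  shows "smooth_vfield A U (\<lambda>q. \<Sum>i\<in>I. Y i q)"
  unfolding smooth_vfield_def
proof
  fix c assume c: "c \<in> A"
  have "smooth_on (snd c ` (fst c \<inter> U)) (\<lambda>x. \<Sum>i\<in>I. vf_rep A c (Y i) x)"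
    by (intro smooth_on_sum open_chart_image c assms smooth_vfieldD)
  then show "smooth_on (snd c ` (fst c \<inter> U)) (vf_rep A c (\<lambda>q. \<Sum>i\<in>I. Y i q))"
    by (rule smooth_on_cong[OF _ open_chart_image[OF c assms(1)]])
      (use c in \<open>auto simp: vf_rep_eq linear_sum[OF linear_crd]\<close>)
qed

text \<open>By the chain rule, the differential, defined in the preferred chart, can be computed in
  whichever chart is convenient.\<close>

lemma df_chart:
  assumes c: "c \<in> A" and p: "p \<in> fst c" and f: "((f \<circ> chart_inv c) has_derivative f') (at (snd c p))"
  shows "df A f p v = f' (crd c p v)"
proof -
  define c0 where "c0 = chart_at A p"
  have c0: "c0 \<in> A" "p \<in> fst c0" using chart_at by (auto simp: c0_def)
  have "((f \<circ> chart_inv c) has_derivative f') (at ((snd c \<circ> chart_inv c0) (snd c0 p)))"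
    using f c0 by simp
  from diff_chain_at[OF has_derivative_transition[OF c0(1) c c0(2) p] this]
  have "((f \<circ> chart_inv c0) has_derivative f' \<circ> coord_change c0 c p) (at (snd c0 p))"
    by (rule has_derivative_transform_within_open[OF _ open_chart_image[OF c0(1) open_fst[OF c]]])
      (use c p c0 in auto)
  then show ?thesis
    by (simp add: df_def fderiv_eqI c0_def)
qed

text \<open>In the preferred chart \<open>chart_at A p\<close>, the bracket of coordinate fields of \<open>c\<close> is the
  antisymmetric part of a second derivative of the transition map.\<close>

lemma bracket_coord_field:
  assumes c: "c \<in> A" and p: "p \<in> fst c"
  shows "bracket A (coord_field A c x) (coord_field A c y) p = 0"
proof -
  define c0 where "c0 = chart_at A p"
  have c0: "c0 \<in> A" "p \<in> fst c0" using chart_at by (auto simp: c0_def)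
  define \<tau> where "\<tau> = snd c0 \<circ> chart_inv c"
  have sm: "smooth_on (snd c ` (fst c \<inter> fst c0)) \<tau>"
    unfolding \<tau>_def by (rule smooth_transition[OF c c0(1)])
  have op: "open (snd c ` (fst c \<inter> fst c0))" by (rule open_chart_image[OF c open_fst[OF c0(1)]])
  have pin: "snd c p \<in> snd c ` (fst c \<inter> fst c0)" using p c0 by auto
  have "fderiv (vf_rep A c0 (coord_field A c w)) (snd c0 p) (coord_field A c v p)
      = fderiv (\<lambda>z. fderiv \<tau> z w) (snd c p) v" for v w
  proof -
    have "((\<lambda>z. fderiv \<tau> z w) has_derivative fderiv (\<lambda>z. fderiv \<tau> z w) (snd c p))
        (at ((snd c \<circ> chart_inv c0) (snd c0 p)))"
      using smooth_on_has_derivative[OF smooth_on_fderiv[OF sm] pin] c0 by simp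
    from diff_chain_at[OF has_derivative_transition[OF c0(1) c c0(2) p] this]
    have "(vf_rep A c0 (coord_field A c w) has_derivative
        fderiv (\<lambda>z. fderiv \<tau> z w) (snd c p) \<circ> coord_change c0 c p) (at (snd c0 p))"
    proof (rule has_derivative_transform_within_open[OF _ open_chart_image[OF c0(1) open_fst[OF c]]])
      fix x assume "x \<in> snd c0 ` (fst c0 \<inter> fst c)"
      then obtain q where q: "q \<in> fst c0" "q \<in> fst c" "x = snd c0 q" by auto
      then show "((\<lambda>z. fderiv \<tau> z w) \<circ> (snd c \<circ> chart_inv c0)) x = vf_rep A c0 (coord_field A c w) x"
        using c0 c coord_change_trans[of c "chart_at A q" c0 q w]
        by (simp add: vf_rep_eq coord_field_def chart_at \<tau>_def coord_change_def[of c c0])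
    qed (use p c0 in auto)
    from fderiv_eqI[OF this] show ?thesis
      using c c0 p by (simp add: c0_def)
  qed
  then show ?thesis
    using fderiv_fderiv_commute[OF op pin sm, of x y]
    by (simp add: bracket_def Let_def flip: c0_def)
qed

end

section \<open>The Levi-Civita connection in a chart\<close>

locale riemannian_manifold = atlas A
  for A :: "('m::{t2_space, second_countable_topology}, 'n::finite) chart set" +
  fixes g :: "('m, 'n) tensor2" and nabla :: "('m, 'n) conn"
  assumes metric: "riemannian_metric A g"
    and levi_civita: "levi_civita A g nabla"
begin

lemma affine_connection: "affine_connection A nabla"
  using levi_civita by (simp add: levi_civita_def)

lemma connection_rules:
  assumes "open U" "smooth_vfield A U X" "smooth_vfield A U Y" "smooth_vfield A U Z" "smooth_function A U f"
  shows "smooth_vfield A U (\<lambda>q. nabla q (X q) Y)"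
    and "\<forall>q\<in>U. Y q = Z q \<Longrightarrow> p \<in> U \<Longrightarrow> nabla p v Y = nabla p v Z"
    and "p \<in> U \<Longrightarrow> linear (\<lambda>v. nabla p v Y)"
    and "p \<in> U \<Longrightarrow> nabla p v (\<lambda>q. Y q + Z q) = nabla p v Y + nabla p v Z"
    and "p \<in> U \<Longrightarrow> nabla p v (\<lambda>q. f q *\<^sub>R Y q) = f p *\<^sub>R nabla p v Y + df A f p v *\<^sub>R Y p"
  using assms affine_connection[unfolded affine_connection_def, THEN spec[where x = U],
    THEN spec[where x = X], THEN spec[where x = Y], THEN spec[where x = Z], THEN spec[where x = f]]
  by blast+

lemma smooth_nabla:
  "open U \<Longrightarrow> smooth_vfield A U X \<Longrightarrow> smooth_vfield A U Y \<Longrightarrow> smooth_vfield A U (\<lambda>q. nabla q (X q) Y)"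
  by (rule connection_rules(1)[OF _ _ _ _ smooth_function_const])

lemma nabla_cong:
  assumes "open U" "smooth_vfield A U Y" "\<And>q. q \<in> U \<Longrightarrow> Y q = Z q" "p \<in> U"
  shows "nabla p v Y = nabla p v Z"
  using connection_rules(2)[OF assms(1,2,2) smooth_vfield_cong[OF assms(2,1,3)] smooth_function_const] assms(3,4)
  by blast

lemma linear_nabla: "open U \<Longrightarrow> smooth_vfield A U Y \<Longrightarrow> p \<in> U \<Longrightarrow> linear (\<lambda>v. nabla p v Y)"
  by (rule connection_rules(3)[OF _ _ _ _ smooth_function_const])

lemma nabla_add:
  "open U \<Longrightarrow> smooth_vfield A U Y \<Longrightarrow> smooth_vfield A U Z \<Longrightarrow> p \<in> U
    \<Longrightarrow> nabla p v (\<lambda>q. Y q + Z q) = nabla p v Y + nabla p v Z"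
  by (rule connection_rules(4)[OF _ _ _ _ smooth_function_const])

lemma nabla_scale:
  "open U \<Longrightarrow> smooth_vfield A U Y \<Longrightarrow> smooth_function A U f \<Longrightarrow> p \<in> U
    \<Longrightarrow> nabla p v (\<lambda>q. f q *\<^sub>R Y q) = f p *\<^sub>R nabla p v Y + df A f p v *\<^sub>R Y p"
  by (rule connection_rules(5))

lemma torsion_free:
  "open U \<Longrightarrow> smooth_vfield A U X \<Longrightarrow> smooth_vfield A U Y \<Longrightarrow> p \<in> U
    \<Longrightarrow> bracket A X Y p = nabla p (X p) Y - nabla p (Y p) X"
  using levi_civita unfolding levi_civita_def by metis

lemma metric_compatible:
  "open U \<Longrightarrow> smooth_vfield A U X \<Longrightarrow> smooth_vfield A U Y \<Longrightarrow> p \<in> U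
    \<Longrightarrow> df A (\<lambda>q. g q (X q) (Y q)) p v = g p (nabla p v X) (Y p) + g p (X p) (nabla p v Y)"
  using levi_civita unfolding levi_civita_def by metis

lemma nabla_sum:
  assumes "finite I" "open U" "p \<in> U" "\<And>i. i \<in> I \<Longrightarrow> smooth_vfield A U (Y i)"
  shows "nabla p v (\<lambda>q. \<Sum>i\<in>I. Y i q) = (\<Sum>i\<in>I. nabla p v (Y i))"
  using assms(1,4)
proof (induction I rule: finite_induct)
  case empty
  have "smooth_vfield A U (\<lambda>q. 0)"
    using smooth_vfield_sum[of U "{}"] assms(2) by simp
  \<comment> \<open>Additivity for the sum 0 + 0 forces the derivative of the zero field to
    vanish.\<close>
  from nabla_add[OF assms(2) this this assms(3)] show ?case by simp
next
  case (insert i I)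
  then have "nabla p v (\<lambda>q. Y i q + (\<Sum>i\<in>I. Y i q)) = nabla p v (Y i) + nabla p v (\<lambda>q. \<Sum>i\<in>I. Y i q)"
    by (intro nabla_add[OF assms(2) _ _ assms(3)] smooth_vfield_sum[OF assms(2)]) auto
  with insert show ?case by simp
qed

text \<open>The Christoffel symbols of the chart, contracted with \<open>v\<close> and
  \<open>w\<close>.\<close>

definition \<Gamma> :: "('m, 'n) chart \<Rightarrow> real ^ 'n \<Rightarrow> real ^ 'n \<Rightarrow> real ^ 'n \<Rightarrow> real ^ 'n" where
  "\<Gamma> c x v w = vf_rep A c (\<lambda>q. nabla q (coord_field A c v q) (coord_field A c w)) x"

definition G :: "('m, 'n) chart \<Rightarrow> real ^ 'n \<Rightarrow> real ^ 'n \<Rightarrow> real ^ 'n \<Rightarrow> real" where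
  "G c x v w = (\<lambda>q. g q (coord_field A c v q) (coord_field A c w q)) (chart_inv c x)"

lemma \<Gamma>_eq:
  "c \<in> A \<Longrightarrow> q \<in> fst c \<Longrightarrow> \<Gamma> c (snd c q) v w = crd c q (nabla q (coord_field A c v q) (coord_field A c w))"
  by (simp add: \<Gamma>_def vf_rep_eq)

lemma G_crd: "c \<in> A \<Longrightarrow> q \<in> fst c \<Longrightarrow> G c (snd c q) (crd c q v) (crd c q w) = g q v w"
  by (simp add: G_def)

lemma bilinear_g: "bilinear (g p)"
  and commute_g: "g p v w = g p w v"
  and positive_g: "v \<noteq> 0 \<Longrightarrow> g p v v > 0"
  using metric by (auto simp: riemannian_metric_def)

lemma smooth_\<Gamma>:
  assumes "c \<in> A"
  shows "smooth_on (snd c ` fst c) (\<lambda>x. \<Gamma> c x v w)"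
  using smooth_vfieldD[OF smooth_nabla[OF open_fst smooth_coord_field smooth_coord_field]] assms
  unfolding \<Gamma>_def by fastforce

lemma bilinear_\<Gamma>:
  assumes c: "c \<in> A" and x: "x \<in> snd c ` fst c"
  shows "bilinear (\<Gamma> c x)"
proof -
  obtain q where q: "q \<in> fst c" "x = snd c q" using x by auto
  note sm = smooth_coord_field[OF c]
  have "linear (\<lambda>v. \<Gamma> c x v w)" for w
  proof -
    have "linear (crd c q \<circ> ((\<lambda>v. nabla q v (coord_field A c w)) \<circ> (\<lambda>v. coord_field A c v q)))"
      using c q by (intro linear_compose linear_crd linear_coord_field linear_nabla[OF open_fst sm])
    then show ?thesis using c q by (simp add: \<Gamma>_eq o_def)
  qed
  moreover have "linear (\<lambda>w. \<Gamma> c x v w)" for v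
  proof (rule linearI)
    have "nabla q u (coord_field A c (w + z)) = nabla q u (\<lambda>q. coord_field A c w q + coord_field A c z q)" for u w z
      using c q by (intro nabla_cong[OF open_fst sm]) (auto simp: linear_add[OF linear_coord_field])
    moreover have "\<dots> u w z = nabla q u (coord_field A c w) + nabla q u (coord_field A c z)" for u w z
      by (rule nabla_add[OF open_fst[OF c] sm sm q(1)])
    ultimately show "\<Gamma> c x v (w + z) = \<Gamma> c x v w + \<Gamma> c x v z" for w z
      using c q by (simp add: \<Gamma>_eq linear_add[OF linear_crd])
    \<comment> \<open>A constant factor has zero differential, so the Leibniz rule reduces to
      homogeneity in \<open>w\<close>.\<close>
    have d: "df A (\<lambda>q. k) q u = 0" for k :: real and u
      by (simp add: df_def o_def)
    have "nabla q u (coord_field A c (k *\<^sub>R w)) = nabla q u (\<lambda>q. k *\<^sub>R coord_field A c w q)" for u w k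
      using c q by (intro nabla_cong[OF open_fst sm]) (auto simp: linear_scale[OF linear_coord_field])
    moreover have "\<dots> u w k = k *\<^sub>R nabla q u (coord_field A c w)" for u w k
      using nabla_scale[OF open_fst[OF c] sm smooth_function_const q(1), of u k w] by (simp add: d)
    ultimately show "\<Gamma> c x v (k *\<^sub>R w) = k *\<^sub>R \<Gamma> c x v w" for k w
      using c q by (simp add: \<Gamma>_eq linear_scale[OF linear_crd])
  qed
  ultimately show ?thesis by (simp add: bilinear_def)
qed

text \<open>Torsion-freeness for two coordinate fields of the same chart, whose bracket is
  zero.\<close>

lemma commute_\<Gamma>:
  assumes c: "c \<in> A" and x: "x \<in> snd c ` fst c"
  shows "\<Gamma> c x v w = \<Gamma> c x w v"
proof -
  obtain q where q: "q \<in> fst c" "x = snd c q" using x by auto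
  have "nabla q (coord_field A c v q) (coord_field A c w) = nabla q (coord_field A c w q) (coord_field A c v)"
    using torsion_free[OF open_fst[OF c] smooth_coord_field[OF c] smooth_coord_field[OF c] q(1), of v w]
      bracket_coord_field[OF c q(1), of v w] by simp
  then show ?thesis using c q by (simp add: \<Gamma>_eq)
qed

lemma smooth_G:
  assumes "c \<in> A"
  shows "smooth_on (snd c ` fst c) (\<lambda>x. G c x v w)"
  using metric smooth_functionD[of "fst c" _ c] assms
  unfolding riemannian_metric_def G_def o_def by fastforce

lemma bilinear_G:
  assumes c: "c \<in> A" and x: "x \<in> snd c ` fst c"
  shows "bilinear (G c x)"
  using x c linear_coord_field[OF c] bilinear_g
  by (auto simp: G_def bilinear_def intro: linear_compose[unfolded o_def])

text \<open>The bridge from the manifold to an open subset of \<open>real ^ 'n\<close>: all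
  identities of the coordinate domain become available in every chart of the atlas.\<close>

lemma metric_connection:
  assumes c: "c \<in> A"
  shows "metric_connection (snd c ` fst c) (\<Gamma> c) (G c)"
proof
  show "open (snd c ` fst c)" by (rule open_chart_range[OF c])
  show "smooth_on (snd c ` fst c) (\<lambda>x. \<Gamma> c x v w)" "smooth_on (snd c ` fst c) (\<lambda>x. G c x v w)" for v w
    by (rule smooth_\<Gamma>[OF c] smooth_G[OF c])+
  fix x assume x: "x \<in> snd c ` fst c"
  then obtain q where q: "q \<in> fst c" "x = snd c q" by auto
  show "bilinear (\<Gamma> c x)" "bilinear (G c x)"
    by (rule bilinear_\<Gamma>[OF c x] bilinear_G[OF c x])+
  show "\<Gamma> c x v w = \<Gamma> c x w v" for v w
    by (rule commute_\<Gamma>[OF c x])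
  show "G c x v w = G c x w v" for v w
    by (simp add: G_def commute_g)
  show "G c x v v > 0" if "v \<noteq> 0" for v
    unfolding G_def
  proof (rule positive_g)
    show "coord_field A c v (chart_inv c x) \<noteq> 0"
      using that crd_coord_field[OF c q(1), of v] linear_0[OF linear_crd[OF c q(1)]] c q
      by (metis chart_inv_left)
  qed
  fix u v w
  have "((\<lambda>q. g q (coord_field A c v q) (coord_field A c w q)) \<circ> chart_inv c has_derivative
      fderiv (\<lambda>x. G c x v w) x) (at (snd c q))"
    using smooth_on_has_derivative[OF smooth_G[OF c] x, of v w] q by (simp add: G_def o_def)
  from df_chart[OF c q(1) this, of "coord_field A c u q"]
  show "fderiv (\<lambda>y. G c y v w) x u = G c x (\<Gamma> c x u v) w + G c x v (\<Gamma> c x u w)"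
    using metric_compatible[OF open_fst[OF c] smooth_coord_field[OF c] smooth_coord_field[OF c] q(1),
        of v w "coord_field A c u q"] c q
    by (simp add: \<Gamma>_eq G_def)
qed

text \<open>The connection is known only through its axioms. Locality allows \<open>Y\<close> to be
  replaced near \<open>p\<close> by a combination of coordinate fields \<open>e i\<close> with
  smooth coefficients \<open>f i\<close>, on which additivity and the Leibniz rule act.\<close>

lemma crd_nabla:
  assumes c: "c \<in> A" and U: "open U" "p \<in> U" and p: "p \<in> fst c" and Y: "smooth_vfield A U Y"
  shows "crd c p (nabla p v Y) = fderiv (vf_rep A c Y) (snd c p) (crd c p v)
    + \<Gamma> c (snd c p) (crd c p v) (crd c p (Y p))"
proof -
  define V where "V = fst c \<inter> U"
  have V: "open V" "V \<subseteq> fst c" "p \<in> V" "V \<subseteq> U" using U p open_fst[OF c] by (auto simp: V_def)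
  define f where "f i q = vf_rep A c Y (snd c q) $ i" for i q
  define e where "e i = coord_field A c (axis i 1)" for i
  have sY: "smooth_on (snd c ` V) (vf_rep A c Y)"
    using smooth_vfieldD[OF Y c] by (simp add: V_def)
  then have sYi: "smooth_on (snd c ` V) (\<lambda>x. vf_rep A c Y x $ i)" for i
    by (intro smooth_on_bounded_linear[OF bounded_linear_vec_nth] open_chart_image_subset c V)
  have f_inv: "vf_rep A c Y x $ i = (f i \<circ> chart_inv c) x" if "x \<in> snd c ` V" for x i
    using that c V by (auto simp: f_def subset_iff)
  have sf: "smooth_function A V (f i)" for i
    by (rule smooth_functionI[OF c V(1,2) smooth_on_cong[OF sYi open_chart_image_subset[OF c V(1,2)] f_inv]])
  have se: "smooth_vfield A V (e i)" for i
    unfolding e_def by (rule smooth_vfield_subset[OF smooth_coord_field[OF c] V(2)])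
  have "crd c q (f i q *\<^sub>R e i q) = (vf_rep A c Y (snd c q) $ i) *\<^sub>R axis i 1" if "q \<in> V" for i q
    using that c V by (auto simp: f_def e_def subset_iff linear_scale[OF linear_crd])
  then have sfe: "smooth_vfield A V (\<lambda>q. f i q *\<^sub>R e i q)" for i
    by (rule smooth_vfieldI_rep[OF c V(1,2)
          smooth_on_scaleR[OF open_chart_image_subset[OF c V(1,2)] sYi smooth_on_const]])
  have basis: "(\<Sum>i\<in>UNIV. (x $ i) *\<^sub>R axis i 1) = x" for x :: "real ^ 'n"
    using basis_expansion[of x] by (simp add: scalar_mult_eq_scaleR)
  have Y_eq: "Y q = (\<Sum>i\<in>UNIV. f i q *\<^sub>R e i q)" if "q \<in> V" for q
  proof -
    have q: "q \<in> fst c" using that V by auto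
    have "crd c q (\<Sum>i\<in>UNIV. f i q *\<^sub>R e i q) = (\<Sum>i\<in>UNIV. (crd c q (Y q) $ i) *\<^sub>R axis i 1)"
      using c q by (simp add: linear_sum[OF linear_crd[OF c q]] linear_scale[OF linear_crd[OF c q]]
          f_def e_def vf_rep_eq)
    then show ?thesis using crd_inject[OF c q] by (simp add: basis)
  qed
  have df_f: "df A (f i) p v = fderiv (vf_rep A c Y) (snd c p) (crd c p v) $ i" for i
  proof (rule df_chart[OF c p])
    have "((\<lambda>x. vf_rep A c Y x $ i) has_derivative (\<lambda>u. fderiv (vf_rep A c Y) (snd c p) u $ i)) (at (snd c p))"
      using V by (intro bounded_linear.has_derivative[OF bounded_linear_vec_nth] smooth_on_has_derivative[OF sY]) auto
    then show "(f i \<circ> chart_inv c has_derivative (\<lambda>u. fderiv (vf_rep A c Y) (snd c p) u $ i)) (at (snd c p))"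
      by (rule has_derivative_transform_within_open[OF _ open_chart_image_subset[OF c V(1,2)] _ f_inv])
        (use V in auto)
  qed
  have "nabla p v Y = nabla p v (\<lambda>q. \<Sum>i\<in>UNIV. f i q *\<^sub>R e i q)"
    by (rule nabla_cong[OF V(1) smooth_vfield_subset[OF Y V(4)] Y_eq V(3)])
  also have "\<dots> = (\<Sum>i\<in>UNIV. f i p *\<^sub>R nabla p v (e i) + df A (f i) p v *\<^sub>R e i p)"
    unfolding nabla_sum[OF finite V(1,3) sfe] by (intro sum.cong refl nabla_scale[OF V(1) se sf V(3)])
  finally have "crd c p (nabla p v Y) = (\<Sum>i\<in>UNIV. f i p *\<^sub>R crd c p (nabla p v (e i))
      + fderiv (vf_rep A c Y) (snd c p) (crd c p v) $ i *\<^sub>R axis i 1)"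
    using c p by (simp add: linear_sum[OF linear_crd] linear_add[OF linear_crd] linear_scale[OF linear_crd] e_def df_f)
  also have "\<dots> = (\<Sum>i\<in>UNIV. f i p *\<^sub>R \<Gamma> c (snd c p) (crd c p v) (axis i 1))
      + fderiv (vf_rep A c Y) (snd c p) (crd c p v)"
    using c p by (simp add: sum.distrib basis \<Gamma>_eq e_def)
  also have "(\<Sum>i\<in>UNIV. f i p *\<^sub>R \<Gamma> c (snd c p) (crd c p v) (axis i 1))
      = \<Gamma> c (snd c p) (crd c p v) (\<Sum>i\<in>UNIV. f i p *\<^sub>R axis i 1)"
    using bilinear_\<Gamma>[OF c, of "snd c p"] p
    by (simp add: linear_sum[of "\<Gamma> c (snd c p) (crd c p v)"] linear_scale[of "\<Gamma> c (snd c p) (crd c p v)"] bilinear_def)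
  also have "(\<Sum>i\<in>UNIV. f i p *\<^sub>R axis i 1) = crd c p (Y p)"
    using c p by (simp add: f_def basis vf_rep_eq)
  finally show ?thesis by simp
qed

end

section \<open>Curvature and scalar curvature in a chart\<close>

context riemannian_manifold
begin

abbreviation "Riem c \<equiv> smooth_connection.riem (\<Gamma> c)"
abbreviation "Ric c \<equiv> smooth_connection.ric (\<Gamma> c)"
abbreviation "cov_Ric c \<equiv> smooth_connection.cov_ric (\<Gamma> c)"

lemma smooth_connection: "c \<in> A \<Longrightarrow> smooth_connection (snd c ` fst c) (\<Gamma> c)"
  using metric_connection by (simp add: metric_connection_def)

text \<open>The extensions inside \<open>curvature\<close> are coordinate fields of the preferred
  chart \<open>c0\<close>. Seen in \<open>c\<close> they vary, but their bracket vanishes, as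
  \<open>covariant_commutator\<close> requires.\<close>

lemma crd_curvature:
  assumes c: "c \<in> A" and p: "p \<in> fst c"
  shows "crd c p (curvature A nabla p x y z) = Riem c (snd c p) (crd c p x) (crd c p y) (crd c p z)"
proof -
  interpret C: smooth_connection "snd c ` fst c" "\<Gamma> c" by (rule smooth_connection[OF c])
  define c0 where "c0 = chart_at A p"
  have c0: "c0 \<in> A" "p \<in> fst c0" using chart_at by (auto simp: c0_def)
  define X Y Z where "X = coord_field A c0 x" and "Y = coord_field A c0 y" and "Z = coord_field A c0 z"
  note XYZ = X_def Y_def Z_def
  have ext: "ext_at A p x = X" "ext_at A p y = Y" "ext_at A p z = Z"
    by (simp_all add: ext_at_def XYZ c0_def)
  have at_p: "X p = x" "Y p = y" "Z p = z" by (simp_all add: XYZ c0_def)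
  have sm: "smooth_vfield A (fst c0) X" "smooth_vfield A (fst c0) Y" "smooth_vfield A (fst c0) Z"
    unfolding XYZ by (rule smooth_coord_field[OF c0(1)])+
  note op = open_fst[OF c0(1)]
  have bracket: "bracket A X Y p = 0" unfolding XYZ by (rule bracket_coord_field[OF c0])
  have "curvature A nabla p x y z = nabla p x (\<lambda>q. nabla q (Y q) Z) - nabla p y (\<lambda>q. nabla q (X q) Z)"
    by (simp add: curvature_def Let_def ext bracket linear_0[OF linear_nabla[OF op sm(3) c0(2)]])
  then have R: "crd c p (curvature A nabla p x y z)
      = crd c p (nabla p x (\<lambda>q. nabla q (Y q) Z)) - crd c p (nabla p y (\<lambda>q. nabla q (X q) Z))"
    by (simp add: linear_diff[OF linear_crd[OF c p]])
  define U where "U = snd c ` (fst c \<inter> fst c0)"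
  have U: "open U" "snd c p \<in> U" "U \<subseteq> snd c ` fst c"
    using p c0 open_chart_image[OF c op] by (auto simp: U_def)
  \<comment> \<open>The coordinate formula for the inner covariant derivative holds on the whole
    overlap of the two charts, which is open, so both sides may be differentiated at
    \<open>p\<close>.\<close>
  have rep_nabla: "fderiv (vf_rep A c (\<lambda>q. nabla q (V q) Z)) (snd c p) =
      fderiv (\<lambda>y. fderiv (vf_rep A c Z) y (vf_rep A c V y) + \<Gamma> c y (vf_rep A c V y) (vf_rep A c Z y)) (snd c p)"
    if V: "smooth_vfield A (fst c0) V" for V
  proof (rule fderiv_cong[symmetric, OF U(1,2)])
    show "vf_rep A c (\<lambda>q. nabla q (V q) Z) differentiable at (snd c p)"
      using smooth_vfieldD[OF smooth_nabla[OF op V sm(3)] c] U(2)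
      by (auto simp: U_def intro: smooth_on_differentiable)
    fix y assume "y \<in> U"
    then obtain q where q: "q \<in> fst c" "q \<in> fst c0" "y = snd c q" by (auto simp: U_def)
    show "vf_rep A c (\<lambda>q. nabla q (V q) Z) y =
        fderiv (vf_rep A c Z) y (vf_rep A c V y) + \<Gamma> c y (vf_rep A c V y) (vf_rep A c Z y)"
      using crd_nabla[OF c op q(2,1) sm(3), of "V q"] q c by (simp add: vf_rep_eq)
  qed
  have sU: "smooth_on U (vf_rep A c V)" if "smooth_vfield A (fst c0) V" for V
    using smooth_vfieldD[OF that c] by (simp add: U_def)
  \<comment> \<open>Zero bracket and zero torsion equate the two covariant derivatives; removing the
    symmetric Christoffel terms leaves the commuting condition in the coordinates of
    \<open>c\<close>.\<close>
  have "crd c p (nabla p x Y) = crd c p (nabla p y X)"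
    using torsion_free[OF op sm(1,2) c0(2)] bracket at_p by simp
  then have XY: "fderiv (vf_rep A c Y) (snd c p) (vf_rep A c X (snd c p))
      = fderiv (vf_rep A c X) (snd c p) (vf_rep A c Y (snd c p))"
    using C.commute_\<Gamma>[of "snd c p" "crd c p x" "crd c p y"] c p at_p
    by (simp add: crd_nabla[OF c op c0(2) p] sm vf_rep_eq)
  have "crd c p (curvature A nabla p x y z)
      = Riem c (snd c p) (vf_rep A c X (snd c p)) (vf_rep A c Y (snd c p)) (vf_rep A c Z (snd c p))"
    unfolding R C.covariant_commutator[OF U(1,2,3) smooth_on_differentiable[OF sU[OF sm(1)] U(2)]
        smooth_on_differentiable[OF sU[OF sm(2)] U(2)] sU[OF sm(3)] XY, symmetric]
    using c p at_p by (simp add: crd_nabla[OF c op c0(2) p] smooth_nabla[OF op] sm rep_nabla vf_rep_eq)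
  then show ?thesis using c p at_p by (simp add: vf_rep_eq)
qed

text \<open>\<open>ricci\<close> traces over components in the preferred chart. The change to
  \<open>c\<close> conjugates the curvature endomorphism, which leaves its trace unchanged.\<close>

lemma ricci_chart:
  assumes c: "c \<in> A" and p: "p \<in> fst c"
  shows "ricci A nabla p y z = Ric c (snd c p) (crd c p y) (crd c p z)"
proof -
  interpret C: smooth_connection "snd c ` fst c" "\<Gamma> c" by (rule smooth_connection[OF c])
  have "ricci A nabla p y z
      = tr (\<lambda>x. coord_field A c (Riem c (snd c p) (crd c p x) (crd c p y) (crd c p z)) p)"
    unfolding ricci_def crd_curvature[OF c p, symmetric] using c p by simp
  also have "\<dots> = tr (\<lambda>x. Riem c (snd c p) (crd c p (coord_field A c x p)) (crd c p y) (crd c p z))"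
    using p by (intro tr_compose_commute linear_coord_field[OF c]
        linear_compose[OF linear_crd[OF c p] C.linear_riem(1), unfolded o_def]) auto
  finally show ?thesis using c p by (simp add: C.ric_def)
qed

lemma bilinear_ricci: "bilinear (ricci A nabla p)"
proof -
  define c where "c = chart_at A p"
  have c: "c \<in> A" "p \<in> fst c" using chart_at by (auto simp: c_def)
  interpret C: smooth_connection "snd c ` fst c" "\<Gamma> c" by (rule smooth_connection[OF c(1)])
  have "ricci A nabla p = Ric c (snd c p)"
    using c by (intro ext) (simp add: ricci_chart[OF c] c_def)
  then show ?thesis using C.bilinear_ric[of "snd c p"] c by simp
qed

text \<open>In the preferred chart of \<open>p\<close> the components at \<open>p\<close> need no
  conversion, and the extensions used by \<open>cov_tensor\<close> have constant components
  there.\<close>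

lemma cov_tensor_chart_at:
  assumes "c = chart_at A p"
    and "((\<lambda>x. T (chart_inv c x) (coord_field A c y (chart_inv c x)) (coord_field A c z (chart_inv c x)))
      has_derivative T') (at (snd c p))"
  shows "cov_tensor A nabla T p x y z = T' x - T p (\<Gamma> c (snd c p) x y) z - T p y (\<Gamma> c (snd c p) x z)"
proof -
  have c: "c \<in> A" "p \<in> fst c" using chart_at assms(1) by auto
  have crd: "crd c p v = v" for v using c by (simp add: assms(1))
  have \<Gamma>: "\<Gamma> c (snd c p) v w = nabla p v (ext_at A p w)" for v w
    using \<Gamma>_eq[OF c, of v w] by (simp add: ext_at_def assms(1) chart_at)
  have "df A (\<lambda>q. T q (ext_at A p y q) (ext_at A p z q)) p x = T' (crd c p x)"
    using assms(2) by (intro df_chart[OF c]) (simp add: ext_at_def assms(1) o_def)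
  then show ?thesis by (simp add: cov_tensor_def Let_def crd \<Gamma>)
qed

text \<open>Guarantees that the choice in \<open>frame_at\<close> really selects an orthonormal
  frame.\<close>

lemma local_orthonormal_frame_exists: "\<exists>E U. p \<in> U \<and> local_orthonormal_frame A g U E"
proof -
  define c where "c = chart_at A p"
  have c: "c \<in> A" "p \<in> fst c" using chart_at by (auto simp: c_def)
  interpret C: metric_connection "snd c ` fst c" "\<Gamma> c" "G c" by (rule metric_connection[OF c(1)])
  obtain U' and E' :: "'n \<Rightarrow> real ^ 'n \<Rightarrow> real ^ 'n" where U': "open U'" "snd c p \<in> U'"
    and sm: "\<And>i. smooth_on U' (E' i)"
    and on: "\<And>x i j. x \<in> U' \<Longrightarrow> G c x (E' i x) (E' j x) = (if i = j then 1 else 0)"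
    using C.orthonormal_frame_exists[of "snd c p"] c by blast
  define U where "U = fst c \<inter> snd c -` U'"
  define E where "E i q = coord_field A c (E' i (snd c q)) q" for i q
  have U: "open U" "U \<subseteq> fst c" "p \<in> U" "snd c ` U \<subseteq> U'"
    using continuous_open_preimage[OF _ open_fst[OF c(1)] U'(1)] chart_homeomorphism[OF c(1)] c U'
    by (auto simp: U_def homeomorphism_def)
  have "smooth_vfield A U (E i)" for i
    by (rule smooth_vfieldI_rep[OF c(1) U(1,2) smooth_on_subset[OF sm U(4)]])
      (use c U in \<open>auto simp: E_def subset_iff\<close>)
  moreover have "g q (E i q) (E j q) = (if i = j then 1 else 0)" if "q \<in> U" for q i j
    using on[of "snd c q" i j] that U c by (auto simp: E_def G_def subset_iff)
  ultimately show ?thesis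
    using U unfolding local_orthonormal_frame_def by blast
qed

lemma frame_at:
  obtains U where "p \<in> U" "local_orthonormal_frame A g U (frame_at A g p)"
  using someI_ex[OF local_orthonormal_frame_exists[of p]] by (auto simp: frame_at_def)

lemma orthonormal_basis_frame:
  "local_orthonormal_frame A g U E \<Longrightarrow> q \<in> U \<Longrightarrow> orthonormal_basis (g q) (\<lambda>i. E i q)"
  by unfold_locales (auto simp: local_orthonormal_frame_def bilinear_g intro: commute_g)

lemma orthonormal_basis_frame_at: "orthonormal_basis (g p) (\<lambda>i. frame_at A g p i p)"
  using frame_at[of p] orthonormal_basis_frame by metis

lemma orthonormal_basis_crd:
  assumes c: "c \<in> A" "q \<in> fst c" and "orthonormal_basis (g q) e"
  shows "orthonormal_basis (G c (snd c q)) (\<lambda>i. crd c q (e i))"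
proof -
  interpret orthonormal_basis "g q" e by fact
  show ?thesis
    by unfold_locales (use c in \<open>auto simp: bilinear_G G_crd orthonormal G_def intro: commute_g\<close>)
qed

lemma has_derivative_scal:
  assumes c: "c \<in> A" and p: "p \<in> fst c"
  shows "((scal A g nabla \<circ> chart_inv c) has_derivative (\<lambda>v. \<Sum>i\<in>UNIV.
    cov_Ric c (snd c p) v (crd c p (frame_at A g p i p)) (crd c p (frame_at A g p i p)))) (at (snd c p))"
proof -
  interpret C: metric_connection "snd c ` fst c" "\<Gamma> c" "G c" by (rule metric_connection[OF c])
  obtain U where U: "p \<in> U" and frame: "local_orthonormal_frame A g U (frame_at A g p)"
    by (rule frame_at)
  define E where "E i = vf_rep A c (frame_at A g p i)" for i
  have opU: "open U" and smE: "smooth_vfield A U (frame_at A g p i)" for i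
    using frame by (auto simp: local_orthonormal_frame_def)
  define V where "V = snd c ` (fst c \<inter> U)"
  have V: "open V" "snd c p \<in> V" "V \<subseteq> snd c ` fst c"
    using open_chart_image[OF c opU] U p by (auto simp: V_def)
  have on: "orthonormal_basis (G c x) (\<lambda>i. E i x)" if x: "x \<in> V" for x
  proof -
    obtain q where q: "q \<in> fst c" "q \<in> U" "x = snd c q" using x by (auto simp: V_def)
    show ?thesis
      using orthonormal_basis_crd[OF c q(1) orthonormal_basis_frame[OF frame q(2)]] c q
      by (simp add: E_def vf_rep_eq)
  qed
  have diff: "E i differentiable at (snd c p)" for i
    using smooth_on_differentiable[OF smooth_vfieldD[OF smE c]] V by (simp add: E_def V_def)
  have "((scal A g nabla \<circ> chart_inv c) has_derivative
      (\<lambda>v. \<Sum>i\<in>UNIV. cov_Ric c (snd c p) v (E i (snd c p)) (E i (snd c p)))) (at (snd c p))"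
  proof (rule has_derivative_transform_within_open[OF C.has_derivative_scal[OF V(2,1,3) on diff] V(1,2)])
    fix x assume "x \<in> V"
    then obtain q where q: "q \<in> fst c" "q \<in> U" "x = snd c q" by (auto simp: V_def)
    \<comment> \<open>\<open>scal\<close> at \<open>q\<close> is defined with the frame selected for
      \<open>q\<close>; basis independence replaces it by the frame selected for \<open>p\<close>,
      which varies smoothly in \<open>q\<close>.\<close>
    have "scal A g nabla q = (\<Sum>i\<in>UNIV. ricci A nabla q (frame_at A g p i q) (frame_at A g p i q))"
      unfolding scal_def
      by (rule contract_basis_independent[OF orthonormal_basis_frame_at
            orthonormal_basis_frame[OF frame q(2)] bilinear_ricci])
    then show "(\<Sum>i\<in>UNIV. Ric c x (E i x) (E i x)) = (scal A g nabla \<circ> chart_inv c) x"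
      using c q by (simp add: ricci_chart[OF c q(1)] E_def vf_rep_eq)
  qed
  then show ?thesis using c p by (simp add: E_def vf_rep_eq)
qed

text \<open>In a chart the derivative of \<open>scal\<close> vanishes on a ball, which is convex, so
  \<open>scal\<close> is locally constant; connectedness makes it constant.\<close>

lemma scal_constant_if_df_0:
  assumes conn: "connected (UNIV :: 'm set)" and df0: "\<And>p v. df A (scal A g nabla) p v = 0"
  shows "\<exists>k. \<forall>p. scal A g nabla p = k"
proof -
  have "\<forall>\<^sub>F q in at p. scal A g nabla p = scal A g nabla q" for p
  proof -
    define c where "c = chart_at A p"
    have c: "c \<in> A" "p \<in> fst c" using chart_at by (auto simp: c_def)
    obtain e where e: "e > 0" "ball (snd c p) e \<subseteq> snd c ` fst c"
      using openE[OF open_chart_range[OF c(1)], of "snd c p"] c by auto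
    define V where "V = fst c \<inter> snd c -` ball (snd c p) e"
    have V: "open V" "p \<in> V"
      using continuous_open_preimage[OF _ open_fst[OF c(1)] open_ball] chart_homeomorphism[OF c(1)] c e
      by (auto simp: V_def homeomorphism_def)
    have D: "((scal A g nabla \<circ> chart_inv c) has_derivative (\<lambda>v. 0)) (at x within ball (snd c p) e)"
      if x: "x \<in> ball (snd c p) e" for x
    proof -
      obtain q where q: "q \<in> fst c" "x = snd c q" using x e by auto
      note d = has_derivative_scal[OF c(1) q(1)]
      have "df A (scal A g nabla) q (coord_field A c v q) = (\<Sum>i\<in>UNIV. cov_Ric c (snd c q) v
          (crd c q (frame_at A g q i q)) (crd c q (frame_at A g q i q)))" for v
        using df_chart[OF c(1) q(1) d, of "coord_field A c v q"] c q by simp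
      then have "((scal A g nabla \<circ> chart_inv c) has_derivative (\<lambda>v. 0)) (at x)"
        using d df0 q by simp
      then show ?thesis by (rule has_derivative_at_withinI)
    qed
    obtain k where k: "\<And>x. x \<in> ball (snd c p) e \<Longrightarrow> (scal A g nabla \<circ> chart_inv c) x = k"
      using has_derivative_zero_constant[OF convex_ball D] by blast
    have "scal A g nabla q = k" if "q \<in> V" for q
      using k[of "snd c q"] that c by (simp add: V_def)
    then show ?thesis
      unfolding eventually_at_topological using V by (intro exI[of _ V]) simp
  qed
  then have "scal A g nabla p = scal A g nabla q" for p q
    by (intro connected_local_const[OF conn]) auto
  then show ?thesis by blast
qed

text \<open>Torsion-freeness writes each bracket as a difference of covariant derivatives; the
  derivatives along \<open>X\<close> cancel against those from metric compatibility.\<close>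

lemma lie_deriv_metric:
  assumes "smooth_vfield A UNIV X"
  shows "lie_deriv A X g p v w = g p (nabla p v X) w + g p v (nabla p w X)"
proof -
  define c where "c = chart_at A p"
  have c: "c \<in> A" "p \<in> fst c" using chart_at by (auto simp: c_def)
  note op = open_fst[OF c(1)] and sm = smooth_coord_field[OF c(1)]
  have smX: "smooth_vfield A (fst c) X" by (rule smooth_vfield_subset[OF assms]) simp
  note bil = bilinear_lsub[OF bilinear_g] bilinear_rsub[OF bilinear_g]
  show ?thesis
    using metric_compatible[OF op sm sm c(2), of v w "X p"] torsion_free[OF op smX sm c(2)]
    by (simp add: lie_deriv_def Let_def ext_at_def bil flip: c_def) (simp add: c_def)
qed

text \<open>Metric compatibility lets the covariant derivative pass through the musical
  isomorphism.\<close>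

lemma cov_form_flat:
  assumes "smooth_vfield A UNIV X"
  shows "cov_form A nabla X (flat g X) p y = g p (nabla p (X p) X) y"
proof -
  define c where "c = chart_at A p"
  have c: "c \<in> A" "p \<in> fst c" using chart_at by (auto simp: c_def)
  have smX: "smooth_vfield A (fst c) X" by (rule smooth_vfield_subset[OF assms]) simp
  show ?thesis
    using metric_compatible[OF open_fst[OF c(1)] smX smooth_coord_field[OF c(1)] c(2), of y "X p"]
    by (simp add: cov_form_def Let_def ext_at_def flat_def flip: c_def) (simp add: c_def)
qed

text \<open>\<open>schroedinger_ricci\<close> asks for some vector field dual to the form;
  nondegeneracy of \<open>g\<close> identifies it with the soliton field.\<close>

lemma flat_inject: "flat g X = flat g Y \<longleftrightarrow> X = Y"
proof
  assume eq: "flat g X = flat g Y"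
  show "X = Y"
  proof
    fix p
    have "g p (X p - Y p) (X p - Y p) = 0"
      using fun_cong[OF fun_cong[OF eq, of p], of "X p - Y p"]
      by (simp add: flat_def bilinear_lsub[OF bilinear_g])
    then show "X p = Y p" using positive_g[of "X p - Y p" p] by fastforce
  qed
qed simp

end

section \<open>Solitons\<close>

locale soliton = riemannian_manifold A g nabla
  for A :: "('m::{t2_space, second_countable_topology}, 'n::finite) chart set" and g nabla +
  fixes \<xi> :: "('m, 'n) vfield" and lam \<mu> :: real
  assumes soliton: "eta_ricci_soliton A g nabla \<xi> (flat g \<xi>) lam \<mu>"
begin

lemma smooth_\<xi>: "smooth_vfield A UNIV \<xi>"
  using soliton by (simp add: eta_ricci_soliton_def)

lemma lie_deriv_soliton:
  "lie_deriv A \<xi> g p v w = - 2 * ricci A nabla p v w - 2 * lam * g p v w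
     - 2 * \<mu> * (g p (\<xi> p) v * g p (\<xi> p) w)"
proof -
  have "lie_deriv A \<xi> g p v w + 2 * ricci A nabla p v w + 2 * lam * g p v w
      + 2 * \<mu> * (g p (\<xi> p) v * g p (\<xi> p) w) = 0"
    using soliton by (simp add: eta_ricci_soliton_def flat_def)
  then show ?thesis by linarith
qed

text \<open>Every other term of the soliton equation is symmetric, the Lie derivative by
  \<open>lie_deriv_metric\<close>.\<close>

lemma commute_ricci: "ricci A nabla p v w = ricci A nabla p w v"
  using lie_deriv_soliton[of p v w] lie_deriv_soliton[of p w v]
  by (simp add: lie_deriv_metric[OF smooth_\<xi>] commute_g mult.commute)

lemma divergence_\<xi>:
  "(\<Sum>i\<in>UNIV. g p (nabla p (frame_at A g p i p) \<xi>) (frame_at A g p i p))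
    = - (scal A g nabla p + lam * real CARD('n) + \<mu> * g p (\<xi> p) (\<xi> p))"
proof -
  interpret orthonormal_basis "g p" "\<lambda>i. frame_at A g p i p" by (rule orthonormal_basis_frame_at)
  let ?E = "\<lambda>i. frame_at A g p i p"
  have "2 * (\<Sum>i\<in>UNIV. g p (nabla p (?E i) \<xi>) (?E i)) = (\<Sum>i\<in>UNIV. lie_deriv A \<xi> g p (?E i) (?E i))"
    by (simp add: lie_deriv_metric[OF smooth_\<xi>] commute_g[of p "?E _"] sum_distrib_left)
  also have "\<dots> = - 2 * scal A g nabla p - 2 * lam * (\<Sum>i\<in>UNIV. g p (?E i) (?E i))
      - 2 * \<mu> * (\<Sum>i\<in>UNIV. g p (\<xi> p) (?E i) * g p (\<xi> p) (?E i))"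
    unfolding lie_deriv_soliton scal_def by (simp add: sum_subtractf sum_distrib_left sum_negf)
  also have "\<dots> = - 2 * (scal A g nabla p + lam * real CARD('n) + \<mu> * g p (\<xi> p) (\<xi> p))"
    unfolding contract_product by (simp add: orthonormal algebra_simps)
  finally show ?thesis by simp
qed

text \<open>The soliton equation expresses the Lie derivative through functions whose derivatives
  are already known. The term with \<open>lam\<close> disappears because the metric is parallel, and
  the last one follows the Leibniz rule for \<open>\<eta> \<otimes> \<eta>\<close>.\<close>

lemma cov_tensor_lie_deriv:
  assumes "c = chart_at A p"
  shows "cov_tensor A nabla (lie_deriv A \<xi> g) p a y z = - 2 * cov_Ric c (snd c p) a y z
    - 2 * \<mu> * (g p (nabla p a \<xi>) y * g p (\<xi> p) z + g p (\<xi> p) y * g p (nabla p a \<xi>) z)"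
proof -
  have c: "c \<in> A" "p \<in> fst c" using chart_at assms by auto
  interpret C: metric_connection "snd c ` fst c" "\<Gamma> c" "G c" by (rule metric_connection[OF c(1)])
  define x where "x = snd c p"
  have x: "x \<in> snd c ` fst c" using c by (simp add: x_def)
  have crd: "crd c p v = v" for v using c by (simp add: assms)
  have Gg: "G c x v w = g p v w" for v w using G_crd[OF c, of v w] by (simp add: crd x_def)
  have Ricci: "ricci A nabla p v w = Ric c x v w" for v w
    using ricci_chart[OF c, of v w] by (simp add: crd x_def)
  define \<xi>c where "\<xi>c = vf_rep A c \<xi>"
  have sm: "smooth_on (snd c ` fst c) \<xi>c"
    using smooth_vfieldD[OF smooth_\<xi> c(1)] by (simp add: \<xi>c_def)
  have \<xi>p: "\<xi>c x = \<xi> p" using c by (simp add: \<xi>c_def x_def vf_rep_eq crd)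
  have nab: "fderiv \<xi>c x a + \<Gamma> c x a (\<xi> p) = nabla p a \<xi>" for a
    using crd_nabla[OF c(1) open_UNIV _ c(2) smooth_\<xi>, of a] by (simp add: crd \<xi>c_def x_def)
  have D1: "((\<lambda>x. G c x y z) has_derivative (\<lambda>u. g p (\<Gamma> c x u y) z + g p y (\<Gamma> c x u z))) (at x)"
    using C.has_derivative_G[OF x has_derivative_const has_derivative_const, of y z] by (simp add: Gg)
  have D2: "((\<lambda>x. G c x (\<xi>c x) w) has_derivative
      (\<lambda>u. g p (nabla p u \<xi>) w + g p (\<xi> p) (\<Gamma> c x u w))) (at x)" for w
    using C.has_derivative_G[OF x smooth_on_has_derivative[OF sm x] has_derivative_const, of w]
    by (simp add: Gg nab \<xi>p)
  define T where "T x = - 2 * Ric c x y z - 2 * lam * G c x y z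
     - 2 * \<mu> * (G c x (\<xi>c x) y * G c x (\<xi>c x) z)" for x
  define T' where "T' u = - 2 * fderiv (\<lambda>x. Ric c x y z) x u
     - 2 * lam * (g p (\<Gamma> c x u y) z + g p y (\<Gamma> c x u z))
     - 2 * \<mu> * (g p (\<xi> p) y * (g p (nabla p u \<xi>) z + g p (\<xi> p) (\<Gamma> c x u z))
        + (g p (nabla p u \<xi>) y + g p (\<xi> p) (\<Gamma> c x u y)) * g p (\<xi> p) z)" for u
  have "(T has_derivative T') (at x)"
    unfolding T_def T'_def
    by (intro has_derivative_diff has_derivative_mult_right D1 smooth_on_has_derivative[OF C.smooth_ric x]
        has_derivative_mult[OF D2 D2, unfolded Gg \<xi>p])
  then have "((\<lambda>x. lie_deriv A \<xi> g (chart_inv c x) (coord_field A c y (chart_inv c x))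
      (coord_field A c z (chart_inv c x))) has_derivative T') (at x)"
  proof (rule has_derivative_transform_within_open[OF _ C.open_W x])
    fix x assume "x \<in> snd c ` fst c"
    then obtain q where q: "q \<in> fst c" "x = snd c q" by auto
    show "T x = lie_deriv A \<xi> g (chart_inv c x) (coord_field A c y (chart_inv c x))
        (coord_field A c z (chart_inv c x))"
      using c q G_crd[OF c(1) q(1), of "\<xi> q" "coord_field A c _ q"]
      by (simp add: lie_deriv_soliton T_def ricci_chart[OF c(1) q(1)] G_def \<xi>c_def vf_rep_eq)
  qed
  from cov_tensor_chart_at[where T = "lie_deriv A \<xi> g", OF assms this[unfolded x_def]] show ?thesis
    unfolding T'_def C.cov_ric_def lie_deriv_soliton Ricci x_def[symmetric]
    by (simp add: algebra_simps)
qed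

lemma div_lie_deriv:
  "div_tensor A g nabla (lie_deriv A \<xi> g) p y = - df A (scal A g nabla) p y
    + 2 * \<mu> * ((scal A g nabla p + lam * real CARD('n) + \<mu> * g p (\<xi> p) (\<xi> p)) * flat g \<xi> p y
      - cov_form A nabla \<xi> (flat g \<xi>) p y)"
proof -
  define c where "c = chart_at A p"
  have c: "c \<in> A" "p \<in> fst c" using chart_at by (auto simp: c_def)
  interpret C: metric_connection "snd c ` fst c" "\<Gamma> c" "G c" by (rule metric_connection[OF c(1)])
  define x where "x = snd c p"
  have x: "x \<in> snd c ` fst c" using c by (simp add: x_def)
  have crd: "crd c p v = v" for v using c by (simp add: c_def)
  have Gg: "G c x = g p" using G_crd[OF c] by (intro ext) (simp add: crd x_def)
  let ?E = "\<lambda>i. frame_at A g p i p"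
  interpret orthonormal_basis "g p" ?E by (rule orthonormal_basis_frame_at)
  have sym: "Ric c y v w = Ric c y w v" if y: "y \<in> snd c ` fst c" for y v w
  proof -
    obtain q where q: "q \<in> fst c" "y = snd c q" using y by auto
    show ?thesis
      using commute_ricci[of q "coord_field A c v q" "coord_field A c w q"] c q
      by (simp add: ricci_chart[OF c(1) q(1)])
  qed
  \<comment> \<open>The contracted Bianchi identity leaves the free vector in the first Ricci slot,
    while the divergence has it in the second; symmetry of the Ricci tensor near \<open>p\<close>
    carries over to its derivative.\<close>
  have cov_sym: "cov_Ric c x a v w = cov_Ric c x a w v" for a v w
  proof -
    have "fderiv (\<lambda>y. Ric c y v w) x = fderiv (\<lambda>y. Ric c y w v) x"
      by (rule fderiv_cong[OF C.open_W x sym smooth_on_differentiable[OF C.smooth_ric x]])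
    then show ?thesis by (simp add: C.cov_ric_def sym[OF x, of v] sym[OF x, of _ w])
  qed
  have "df A (scal A g nabla) p y = (\<Sum>i\<in>UNIV. cov_Ric c x y (?E i) (?E i))"
    using df_chart[OF c has_derivative_scal[OF c], of y] by (simp add: crd x_def)
  also have "\<dots> = 2 * (\<Sum>i\<in>UNIV. cov_Ric c x (?E i) (?E i) y)"
    using C.contracted_bianchi[OF x, of ?E y] orthonormal_basis_axioms
    by (simp add: Gg cov_sym[of "?E _" y])
  finally have bianchi: "df A (scal A g nabla) p y = 2 * (\<Sum>i\<in>UNIV. cov_Ric c x (?E i) (?E i) y)" .
  have "linear (\<lambda>v. g p (nabla p v \<xi>) y)"
    using linear_compose[OF linear_nabla[OF open_UNIV smooth_\<xi>] bilinear_g[of p, unfolded bilinear_def, THEN conjunct2, rule_format]]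
    by (simp add: o_def)
  \<comment> \<open>The coefficients \<open>g p (\<xi> p) (?E i)\<close> reassemble
    \<open>\<xi> p\<close> as the direction of differentiation, so this half of the Leibniz term is
    \<open>\<nabla>_\<xi> \<eta>\<close>. The other half contains the divergence of
    \<open>\<xi>\<close>.\<close>
  then have cov_form: "(\<Sum>i\<in>UNIV. g p (\<xi> p) (?E i) * g p (nabla p (?E i) \<xi>) y) = cov_form A nabla \<xi> (flat g \<xi>) p y"
    using contract_linear[of "\<lambda>v. g p (nabla p v \<xi>) y" "\<xi> p"] by (simp add: cov_form_flat[OF smooth_\<xi>])
  have "div_tensor A g nabla (lie_deriv A \<xi> g) p y = - 2 * (\<Sum>i\<in>UNIV. cov_Ric c x (?E i) (?E i) y)
      - 2 * \<mu> * ((\<Sum>i\<in>UNIV. g p (nabla p (?E i) \<xi>) (?E i)) * g p (\<xi> p) y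
        + cov_form A nabla \<xi> (flat g \<xi>) p y)"
    unfolding div_tensor_def cov_tensor_lie_deriv[OF c_def] x_def cov_form[symmetric]
    by (simp add: sum_subtractf sum_distrib_left sum_distrib_right sum.distrib sum_negf distrib_left)
  then show ?thesis
    unfolding bianchi divergence_\<xi> by (simp add: flat_def algebra_simps)
qed

lemma schroedinger_ricci_iff:
  "schroedinger_ricci A g nabla (flat g \<xi>) \<longleftrightarrow>
    (\<forall>p y. div_tensor A g nabla (lie_deriv A \<xi> g) p y = 0)"
  using smooth_\<xi> by (auto simp: schroedinger_ricci_def flat_inject)

end

theorem theorem2p1:
  fixes A :: "('m::{t2_space, second_countable_topology}, 'n::finite) chart set"
    and g :: "('m, 'n) tensor2"
    and nabla :: "('m, 'n) conn"
    and \<xi> :: "('m, 'n) vfield"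
    and \<eta> :: "('m, 'n) form1"
    and lam \<mu> :: real
  assumes "smooth_atlas A"
    and "CARD('n) > 2"
    and "riemannian_metric A g"
    and "levi_civita A g nabla"
    and "eta_ricci_soliton A g nabla \<xi> \<eta> lam \<mu>"
    and "\<eta> = flat g \<xi>"
  shows
    "(schroedinger_ricci A g nabla \<eta> \<longleftrightarrow>
       (\<forall>p v. df A (scal A g nabla) p v =
          2 * \<mu> * ((scal A g nabla p + lam * real CARD('n) + \<mu> * g p (\<xi> p) (\<xi> p)) * \<eta> p v
            - cov_form A nabla \<xi> \<eta> p v)))
     \<and> (schroedinger_ricci A g nabla \<eta> \<longrightarrow> connected (UNIV :: 'm set) \<longrightarrow>
         ((\<exists>k. \<forall>p. scal A g nabla p = k) \<longleftrightarrow>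
           \<mu> = 0 \<or>
           (\<forall>p v. (scal A g nabla p + lam * real CARD('n) + \<mu> * g p (\<xi> p) (\<xi> p)) * \<eta> p v
              = cov_form A nabla \<xi> \<eta> p v)))"
proof -
  interpret soliton A g nabla \<xi> lam \<mu>
    by unfold_locales (use assms in auto)
  have iff: "schroedinger_ricci A g nabla \<eta> \<longleftrightarrow>
     (\<forall>p v. df A (scal A g nabla) p v =
        2 * \<mu> * ((scal A g nabla p + lam * real CARD('n) + \<mu> * g p (\<xi> p) (\<xi> p)) * \<eta> p v
          - cov_form A nabla \<xi> \<eta> p v))"
    unfolding assms(6) schroedinger_ricci_iff div_lie_deriv by (simp add: algebra_simps eq_commute)
  have const: "(\<exists>k. \<forall>p. scal A g nabla p = k) \<longleftrightarrow> (\<forall>p v. df A (scal A g nabla) p v = 0)"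
    if "connected (UNIV :: 'm set)"
  proof
    assume "\<exists>k. \<forall>p. scal A g nabla p = k"
    then obtain k where "scal A g nabla = (\<lambda>p. k)" by auto
    then show "\<forall>p v. df A (scal A g nabla) p v = 0" by (simp add: df_def o_def)
  qed (use scal_constant_if_df_0[OF that] in blast)
  show ?thesis
  proof (intro conjI impI iff)
    assume "schroedinger_ricci A g nabla \<eta>" and conn: "connected (UNIV :: 'm set)"
    then have *: "\<forall>p v. df A (scal A g nabla) p v =
        2 * \<mu> * ((scal A g nabla p + lam * real CARD('n) + \<mu> * g p (\<xi> p) (\<xi> p)) * \<eta> p v
          - cov_form A nabla \<xi> \<eta> p v)"
      using iff by blast
    show "(\<exists>k. \<forall>p. scal A g nabla p = k) \<longleftrightarrow> \<mu> = 0 \<or>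
        (\<forall>p v. (scal A g nabla p + lam * real CARD('n) + \<mu> * g p (\<xi> p) (\<xi> p)) * \<eta> p v
          = cov_form A nabla \<xi> \<eta> p v)"
      \<comment> \<open>Under the equation \<open>*\<close>, a vanishing differential means that
        \<open>2 * \<mu>\<close> times the bracket is zero at all \<open>p\<close> and
        \<open>v\<close>; since \<open>\<mu>\<close> does not depend on them, either it is zero or
        the bracket vanishes everywhere.\<close>
      unfolding const[OF conn] using * by (cases "\<mu> = 0") simp_all
  qed
qed

end
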